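(* Let $T_t$ be a tree on $t$ vertices and let $3\le r\le t-1$. Suppose that $T_t$ has at least $t-r$ leaves with a common parent, i.e. there is a vertex of $T_t$ having at least $t-r$ neighbours of degree $1$ in $T_t$. Let $$n=\alpha(t-1)+\beta,\qquad \alpha\ge 0,\qquad 0\le\beta\le t-2,$$ with $\alpha,\beta$ integers. Then $$\operatorname{ex}(n,K_r,T_t)=\alpha\binom{t-1}{r}+\binom{\beta}{r}.$$ Moreover, the extremal graphs (the $n$-vertex $T_t$-free graphs with exactly $\operatorname{ex}(n,K_r,T_t)$ copies of $K_r$) are exactly the graphs $$G=\alpha K_{t-1}\,\dot\cup\, H,$$ where $H=K_\beta$ if $\beta\ge r$, while $H$ is an arbitrary graph on $\beta$ vertices if $\beta<r$.
   Context: All graphs are finite, simple and undirected. $K_m$ is the complete graph on $m$ vertices ($K_0$ is the empty graph with no vertices). A graph $G$ is $F$-free if it contains no (not necessarily induced) subgraph isomorphic to $F$. For graphs $H,F$, $\operatorname{ex}(n,H,F)$ is the maximum number of copies of $H$ (as subgraphs) in an $n$-vertex $F$-free graph. $G_1\dot\cup G_2$ is the vertex-disjoint union, with no edges between the two graphs, and $mG$ is the disjoint union of $m$ copies of $G$. $\binom{\beta}{r}=0$ when $0\le\beta<r$. A leaf is a vertex of degree $1$; its parent is its unique neighbour. Extremal graphs are described up to isomorphism. *)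

theory Defs
  imports "Graph_Theory.Graph_Theory"
begin

text \<open>
  A finite simple undirected graph is a \<open>G\<close> with \<open>pair_graph G\<close>: finite, loop-free and
  symmetric, the edge \<open>uv\<close> being the two arcs \<open>(u,v)\<close>, \<open>(v,u)\<close>. Hence \<open>out_degree\<close> is the
  number of neighbours, and a subgraph that is isomorphic to a symmetric graph is itself
  symmetric, so that copies counted below are undirected subgraphs.
\<close>

text \<open>
  In a symmetric digraph each edge yields a closed walk \<open>u,v,u\<close>, which the library counts as a
  \<open>cycle\<close>; so the library's \<open>tree\<close> is not the notion for undirected graphs, where cycles have
  length at least 3.
\<close>

definition is_tree :: "'a pair_pre_digraph \<Rightarrow> bool" where
  "is_tree T \<longleftrightarrow> pair_graph T \<and> Digraph_Component.connected (with_proj T) \<and>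
     \<not> (\<exists>p. pre_digraph.cycle (with_proj T) p \<and> 3 \<le> length p)"

definition complete_graph :: "nat \<Rightarrow> nat pair_pre_digraph" where
  "complete_graph m = \<lparr> pverts = {..<m}, parcs = {(u, v). u < m \<and> v < m \<and> u \<noteq> v} \<rparr>"

definition disjoint_union ::
    "'a pair_pre_digraph \<Rightarrow> 'b pair_pre_digraph \<Rightarrow> ('a + 'b) pair_pre_digraph" where
  "disjoint_union G H = \<lparr> pverts = pverts G <+> pverts H,
     parcs = {(Inl u, Inl v) |u v. (u, v) \<in> parcs G} \<union> {(Inr u, Inr v) |u v. (u, v) \<in> parcs H} \<rparr>"

definition disjoint_copies :: "nat \<Rightarrow> 'a pair_pre_digraph \<Rightarrow> (nat \<times> 'a) pair_pre_digraph" where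
  "disjoint_copies m G = \<lparr> pverts = {..<m} \<times> pverts G,
     parcs = {((i, u), (i, v)) |i u v. i < m \<and> (u, v) \<in> parcs G} \<rparr>"

definition copies ::
    "'h pair_pre_digraph \<Rightarrow> 'g pair_pre_digraph \<Rightarrow> ('g, 'g \<times> 'g) pre_digraph set" where
  "copies H G = {S. subgraph S (with_proj G) \<and> digraph_iso (with_proj H) S}"

definition is_free :: "'f pair_pre_digraph \<Rightarrow> 'g pair_pre_digraph \<Rightarrow> bool" where
  "is_free F G \<longleftrightarrow> copies F G = {}"

definition free_graphs :: "nat \<Rightarrow> 'f pair_pre_digraph \<Rightarrow> 'g pair_pre_digraph set" where
  "free_graphs n F = {G. pair_graph G \<and> card (pverts G) = n \<and> is_free F G}"

text \<open>
  Every finite graph is isomorphic to one with vertices in \<^typ>\<open>nat\<close>, so the maximum may be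
  taken over those. The set of values is finite; it is nonempty whenever \<open>F\<close> has an edge.
\<close>

definition ex :: "nat \<Rightarrow> 'h pair_pre_digraph \<Rightarrow> 'f pair_pre_digraph \<Rightarrow> nat" where
  "ex n H F = Max ((\<lambda>G. card (copies H G)) ` (free_graphs n F :: nat pair_pre_digraph set))"

definition extremal ::
    "nat \<Rightarrow> 'h pair_pre_digraph \<Rightarrow> 'f pair_pre_digraph \<Rightarrow> 'g pair_pre_digraph \<Rightarrow> bool" where
  "extremal n H F G \<longleftrightarrow> G \<in> free_graphs n F \<and> card (copies H G) = ex n H F"

end

theory Submission
  imports Defs
begin

text \<open>
  Put \<open>D = t - 1\<close>. The tree enters the upper bound only through a degree condition: removing
  \<open>t - r\<close> leaves with common parent \<open>p\<close> leaves a tree on \<open>r\<close> vertices, which embeds into any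
  \<open>r\<close>-clique with \<open>p\<close> placed on a prescribed vertex \<open>z\<close>; if \<open>z\<close> has \<open>D\<close> neighbours, there is room
  outside the clique for the leaves. Hence in a \<open>T\<close>-free graph every vertex of an \<open>r\<close>-clique has
  degree less than \<open>D\<close> (\<open>free_imp_degree_lt\<close>).

  It remains to maximise the number of \<open>r\<close>-cliques under this degree condition, which for graphs
  of bounded maximum degree is the conjecture of Gan, Loh and Sudakov, proved by Chase. The idea is
  to find a vertex \<open>z\<close> in a clique such that at most \<open>Suc d choose r\<close> cliques meet its closed
  neighbourhood, \<open>d\<close> being its degree, to delete this neighbourhood, and to use induction. Such
  a \<open>z\<close> exists by averaging (\<open>sum_touching_le\<close>): comparing \<open>r\<close>-cliques that meet \<open>N[z]\<close> with \<open>r\<close>-sets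
  contained in \<open>N[z]\<close>, the cliques inside \<open>N[z]\<close> cancel, and the remaining objects on both sides
  live on sets of \<open>Suc r\<close> vertices. There, a clique plus a vertex \<open>z\<close> adjacent to some but not all of
  it is compensated by a vertex adjacent to everything (\<open>almost_clique_le_cone\<close>). The induction
  closes because the claimed maximum \<open>clique_bound\<close> is superadditive when a block of at most \<open>D\<close>
  vertices is split off.

  If the bound is attained, no \<open>z\<close> has fewer than \<open>Suc d choose r\<close> touching cliques, so the averaging
  inequality is tight. Part of its slack are the non-cliques \<open>R\<close> with \<open>z \<in> R \<subseteq> N[z]\<close>. As there
  are none, \<open>N[z]\<close> is a clique for each vertex \<open>z\<close> of an \<open>r\<close>-clique, hence a component, and strict
  superadditivity forces its size to be \<open>D\<close> or \<open>\<beta>\<close>. Peeling off components gives the structure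
  \<open>clique_decomposition\<close>. Conversely, a graph of this form has no room for the connected graph
  \<open>T\<close>, as every component has at most \<open>D < t\<close> vertices, and its cliques are easily counted.
\<close>

section \<open>The claimed maximum as a function of the number of vertices\<close>

definition clique_bound :: "nat \<Rightarrow> nat \<Rightarrow> nat \<Rightarrow> nat" where
  "clique_bound D r n = (n div D) * (D choose r) + ((n mod D) choose r)"

text \<open>
  Discrete convexity of \<open>\<lambda>x. x choose r\<close>: its increment over a step of length \<open>e\<close> grows with the
  starting point.
\<close>
lemma binomial_spread:
  assumes "x \<le> y"
  shows "(x + e choose r) + (y choose r) \<le> (y + e choose r) + (x choose r)"
proof (induction e)
  case (Suc e)
  show ?case
  proof (cases r)
    case (Suc q)
    have "x + e choose q \<le> y + e choose q"
      using assms by (intro binomial_right_mono) auto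
    with Suc.IH show ?thesis by (simp add: Suc)
  qed simp
qed simp

lemma binomial_strict_mono_top:
  assumes "x < y" "1 \<le> q" "q \<le> y"
  shows "(x choose q) < (y choose q)"
proof -
  obtain p y' where p: "q = Suc p" and y': "y = Suc y'"
    using assms by (metis Suc_le_D less_imp_Suc_add One_nat_def)
  have "x choose q \<le> y' choose q"
    using assms y' by (intro binomial_right_mono) auto
  moreover have "0 < y' choose p" using assms p y' by simp
  moreover have "y choose q = (y' choose p) + (y' choose q)" by (simp add: p y')
  ultimately show ?thesis by linarith
qed

lemma binomial_spread_strict:
  assumes "x < y" "0 < e" "2 \<le> r" "r \<le> Suc y"
  shows "(x + e choose r) + (y choose r) < (y + e choose r) + (x choose r)"
proof -
  obtain e' q where e': "e = Suc e'" and q: "r = Suc q"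
    using assms by (metis Suc_le_D gr0_implies_Suc numeral_2_eq_2)
  have "(x + e' choose r) + (y choose r) \<le> (y + e' choose r) + (x choose r)"
    using assms by (intro binomial_spread) simp
  moreover have "x + e' choose q < y + e' choose q"
    using assms q by (intro binomial_strict_mono_top) auto
  ultimately show ?thesis by (simp add: e' q)
qed

lemma clique_bound_remove_small:
  assumes "a \<le> n mod D"
  shows "clique_bound D r (n - a) = (n div D) * (D choose r) + (n mod D - a choose r)"
proof (cases "D = 0")
  case False
  have "n - a = (n mod D - a) + D * (n div D)"
    using assms mult_div_mod_eq[of D n] by linarith
  moreover have "n mod D - a < D" using False mod_less_divisor[of D n] by linarith
  ultimately show ?thesis by (simp add: clique_bound_def)
qed (simp add: clique_bound_def)

lemma clique_bound_remove_large:
  assumes "n mod D < a" "a \<le> D" "a \<le> n"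
  shows "(D choose r) + clique_bound D r (n - a)
    = (n div D) * (D choose r) + (n mod D + (D - a) choose r)"
proof -
  have "0 < D" using assms by linarith
  have "n div D \<noteq> 0" using assms mult_div_mod_eq[of D n] by (metis add.left_neutral leD mult_0_right)
  then obtain k where k: "n div D = Suc k" by (metis not0_implies_Suc)
  have "n - a = (n mod D + (D - a)) + D * k"
    using assms mult_div_mod_eq[of D n] by (simp add: k)
  moreover have "n mod D + (D - a) < D" using assms by linarith
  ultimately show ?thesis by (simp add: clique_bound_def k)
qed

text \<open>
  Splitting \<open>a\<close> vertices off either shrinks the remainder block or breaks one full block of size \<open>D\<close>.
  In both cases the two blocks involved get closer in size while their total stays the same, which
  by convexity cannot increase the number of cliques.
\<close>
lemma clique_bound_superadditive:
  assumes "a \<le> D" "a \<le> n" "1 \<le> r"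
  shows "(a choose r) + clique_bound D r (n - a) \<le> clique_bound D r n"
proof (cases "a \<le> n mod D")
  case True
  have "(0 + (n mod D - a) choose r) + (a choose r) \<le> (a + (n mod D - a) choose r) + (0 choose r)"
    by (rule binomial_spread) simp
  moreover have "(0::nat) choose r = 0" using assms by (simp add: binomial_eq_0)
  ultimately have "(a choose r) + (n mod D - a choose r) \<le> n mod D choose r" using True by simp
  then show ?thesis unfolding clique_bound_remove_small[OF True] by (simp add: clique_bound_def)
next
  case False
  have "(n mod D + (D - a) choose r) + (a choose r) \<le> (a + (D - a) choose r) + (n mod D choose r)"
    using False by (intro binomial_spread) simp
  then show ?thesis
    using clique_bound_remove_large[of n D a r] assms False by (simp add: clique_bound_def)
qed

text \<open>
  Since \<open>a \<ge> r\<close>, convexity is strict at \<open>a\<close>, so nothing is lost only if the multiset of block sizes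
  is unchanged.
\<close>
lemma clique_bound_additive_only:
  assumes "a \<le> D" "a \<le> n" "2 \<le> r" "r \<le> a"
    and eq: "(a choose r) + clique_bound D r (n - a) = clique_bound D r n"
  shows "a = D \<or> a = n mod D"
proof (rule ccontr)
  assume neq: "\<not> ?thesis"
  show False
  proof (cases "a \<le> n mod D")
    case True
    have "(0 + (n mod D - a) choose r) + (a choose r) < (a + (n mod D - a) choose r) + (0 choose r)"
      using assms True neq by (intro binomial_spread_strict) auto
    moreover have "(0::nat) choose r = 0" using assms by (simp add: binomial_eq_0)
    ultimately have "(a choose r) + (n mod D - a choose r) < n mod D choose r" using True by simp
    then show ?thesis using eq unfolding clique_bound_remove_small[OF True] by (simp add: clique_bound_def)
  next
    case False
    have "(n mod D + (D - a) choose r) + (a choose r) < (a + (D - a) choose r) + (n mod D choose r)"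
      using False assms neq by (intro binomial_spread_strict) auto
    then show ?thesis
      using clique_bound_remove_large[of n D a r] assms False by (simp add: clique_bound_def)
  qed
qed

section \<open>Double counting cliques near a vertex\<close>

definition clique :: "'v rel \<Rightarrow> 'v set \<Rightarrow> bool" where
  "clique E S \<longleftrightarrow> (\<forall>u\<in>S. \<forall>v\<in>S. u \<noteq> v \<longrightarrow> (u, v) \<in> E)"

definition cliques :: "'v rel \<Rightarrow> nat \<Rightarrow> 'v set \<Rightarrow> 'v set set" where
  "cliques E r V = {S. S \<subseteq> V \<and> card S = r \<and> clique E S}"

text \<open>
  Everything is relative to a vertex set \<open>V\<close> that shrinks during the induction, while the relation \<open>E\<close>
  stays the same.
\<close>
definition nbhd :: "'v rel \<Rightarrow> 'v set \<Rightarrow> 'v \<Rightarrow> 'v set" where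
  "nbhd E V z = {w \<in> V. (z, w) \<in> E}"

abbreviation closed_nbhd :: "'v rel \<Rightarrow> 'v set \<Rightarrow> 'v \<Rightarrow> 'v set" where
  "closed_nbhd E V z \<equiv> insert z (nbhd E V z)"

text \<open>
  The cliques that are destroyed when the closed neighbourhood of \<open>z\<close> is deleted.
\<close>
definition touching :: "'v rel \<Rightarrow> nat \<Rightarrow> 'v set \<Rightarrow> 'v \<Rightarrow> 'v set set" where
  "touching E r V z = {S \<in> cliques E r V. S \<inter> closed_nbhd E V z \<noteq> {}}"

text \<open>
  These sets contribute to the slack of the averaging inequality. If the closed neighbourhood of \<open>z\<close>
  has at least \<open>r \<ge> 3\<close> vertices and there are no defects, it is a clique.
\<close>
definition defects :: "'v rel \<Rightarrow> nat \<Rightarrow> 'v set \<Rightarrow> 'v \<Rightarrow> 'v set set" where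
  "defects E r V z = {R. z \<in> R \<and> R \<subseteq> closed_nbhd E V z \<and> card R = r \<and> \<not> clique E R}"

lemma cliqueD: "clique E S \<Longrightarrow> u \<in> S \<Longrightarrow> v \<in> S \<Longrightarrow> u \<noteq> v \<Longrightarrow> (u, v) \<in> E"
  by (auto simp: clique_def)

lemma clique_subset: "clique E S \<Longrightarrow> R \<subseteq> S \<Longrightarrow> clique E R"
  by (auto simp: clique_def)

lemma cliques_mono: "W \<subseteq> V \<Longrightarrow> cliques E r W \<subseteq> cliques E r V"
  by (auto simp: cliques_def)

lemma finite_cliques: "finite V \<Longrightarrow> finite (cliques E r V)"
  by (rule finite_subset[of _ "Pow V"]) (auto simp: cliques_def)

lemma finite_nbhd: "finite V \<Longrightarrow> finite (nbhd E V z)"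
  by (simp add: nbhd_def)

lemma card_cliques_split:
  assumes "finite V"
  shows "card (cliques E r V) = card (touching E r V z) + card (cliques E r (V - closed_nbhd E V z))"
proof -
  have "cliques E r V = touching E r V z \<union> cliques E r (V - closed_nbhd E V z)"
    by (auto simp: touching_def cliques_def)
  moreover have "touching E r V z \<inter> cliques E r (V - closed_nbhd E V z) = {}"
    by (auto simp: touching_def cliques_def)
  moreover have "finite (touching E r V z)" "finite (cliques E r (V - closed_nbhd E V z))"
    using assms finite_cliques[of V E r] by (auto simp: touching_def finite_cliques)
  ultimately show ?thesis by (simp add: card_Un_disjoint)
qed

lemma sum_card_swap:
  assumes "finite A" "finite B"
  shows "(\<Sum>x\<in>A. card {y \<in> B. P x y}) = (\<Sum>y\<in>B. card {x \<in> A. P x y})"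
proof -
  have "(\<Sum>x\<in>A. card {y \<in> B. P x y}) = (\<Sum>x\<in>A. \<Sum>y\<in>B. if P x y then 1 else 0)"
    using assms by (simp add: sum.If_cases Int_def)
  also have "\<dots> = (\<Sum>y\<in>B. \<Sum>x\<in>A. if P x y then 1 else 0)" by (rule sum.swap)
  also have "\<dots> = (\<Sum>y\<in>B. card {x \<in> A. P x y})"
    using assms by (simp add: sum.If_cases Int_def)
  finally show ?thesis .
qed

locale simple_graph =
  fixes E :: "'v rel"
  assumes sym_E: "sym E" and irrefl_E: "irrefl E"
begin

lemma E_sym: "(u, v) \<in> E \<Longrightarrow> (v, u) \<in> E"
  using sym_E by (rule symD)

lemma E_irrefl [simp]: "(v, v) \<notin> E"
  using irrefl_E by (simp add: irrefl_def)

lemma card_closed_nbhd: "finite V \<Longrightarrow> card (closed_nbhd E V z) = Suc (card (nbhd E V z))"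
  by (subst card_insert_disjoint) (auto simp: nbhd_def)

text \<open>
  With \<open>S = U - {z}\<close> this is a clique that meets the closed neighbourhood of \<open>z\<close> without being
  contained in it. Passing to \<open>U\<close> makes such pairs comparable with the pairs of \<open>cone_at\<close>.
\<close>
definition almost_clique_at :: "'v set \<Rightarrow> 'v \<Rightarrow> bool" where
  "almost_clique_at U z \<longleftrightarrow> z \<in> U \<and> clique E (U - {z}) \<and> (\<exists>y\<in>U. (z, y) \<in> E) \<and>
     (\<exists>y\<in>U. y \<noteq> z \<and> (z, y) \<notin> E)"

text \<open>
  The set \<open>U - {x}\<close> contributes to \<open>Suc d choose r\<close> at \<open>x\<close> without being a clique, and so can pay for a
  touching clique elsewhere.
\<close>
definition cone_at :: "'v set \<Rightarrow> 'v \<Rightarrow> bool" where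
  "cone_at U x \<longleftrightarrow> x \<in> U \<and> (\<forall>y\<in>U - {x}. (x, y) \<in> E) \<and> \<not> clique E (U - {x})"

text \<open>
  If \<open>z\<close> is the only vertex whose removal turns \<open>U\<close> into a clique of the required kind, any neighbour
  of \<open>z\<close> in \<open>U\<close> is the apex of a cone. If there is another such vertex \<open>z'\<close>, then \<open>U\<close> is complete up to
  the missing edge \<open>zz'\<close>; then \<open>z\<close> and \<open>z'\<close> are the only ones, and the other \<open>r - 1 \<ge> 2\<close> vertices are
  all apices. The apices found are members of an \<open>r\<close>-clique, so the comparison stays valid when only
  such vertices are counted.
\<close>
lemma almost_clique_le_cone:
  assumes U: "finite U" "card U = Suc r" "3 \<le> r" and "U \<subseteq> V"
  shows "card {z \<in> \<Union>(cliques E r V). almost_clique_at U z}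
       \<le> card {x \<in> \<Union>(cliques E r V). cone_at U x}"
    (is "card ?L \<le> card ?R")
proof (cases "?L = {}")
  case True
  then show ?thesis by (metis card.empty le0)
next
  case False
  have finL: "finite ?L" by (rule finite_subset[OF _ U(1)]) (auto simp: almost_clique_at_def)
  have finR: "finite ?R" by (rule finite_subset[OF _ U(1)]) (auto simp: cone_at_def)
  have inX: "U - {z} \<subseteq> \<Union>(cliques E r V)" if "almost_clique_at U z" for z
  proof -
    have "U - {z} \<in> cliques E r V"
      using that assms by (auto simp: cliques_def almost_clique_at_def)
    then show ?thesis by blast
  qed
  obtain z where z: "z \<in> ?L" using False by blast
  show ?thesis
  proof (cases "?L = {z}")
    case True
    \<comment> \<open>Any neighbour \<open>x\<close> of \<open>z\<close> is an apex; the non-neighbour \<open>y\<close> shows that the base is no clique.\<close>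
    obtain x y where x: "x \<in> U" "(z, x) \<in> E" and y: "y \<in> U" "y \<noteq> z" "(z, y) \<notin> E"
      using z by (auto simp: almost_clique_at_def)
    have "x \<noteq> z" using x by auto
    have "cone_at U x"
      unfolding cone_at_def
    proof (intro conjI ballI)
      show "(x, w) \<in> E" if "w \<in> U - {x}" for w
        using that z x \<open>x \<noteq> z\<close> E_sym[OF x(2)]
        by (cases "w = z") (auto simp: almost_clique_at_def clique_def)
      show "\<not> clique E (U - {x})"
      proof -
        have "z \<in> U - {x}" "y \<in> U - {x}"
          using z x y \<open>x \<noteq> z\<close> by (auto simp: almost_clique_at_def)
        then show ?thesis using y cliqueD[of E "U - {x}" z y] by blast
      qed
    qed fact
    moreover have "x \<in> \<Union>(cliques E r V)" using inX z x \<open>x \<noteq> z\<close> by blast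
    ultimately have "{x} \<subseteq> ?R" by blast
    then have "card {x} \<le> card ?R" using finR card_mono by blast
    then show ?thesis unfolding True by simp
  next
    case False
    then obtain z' where z': "z' \<in> ?L" "z' \<noteq> z" using z by blast
    have az: "almost_clique_at U z" and az': "almost_clique_at U z'" using z z' by auto
    have zU: "z \<in> U" "z' \<in> U" and cl: "clique E (U - {z})" "clique E (U - {z'})"
      using az az' by (auto simp: almost_clique_at_def)
    obtain y where y: "y \<in> U" "y \<noteq> z" "(z, y) \<notin> E" using az by (auto simp: almost_clique_at_def)
    have "y = z'" using cliqueD[OF cl(2), of z y] y zU z'(2) by blast
    then have nonadj: "(z, z') \<notin> E" using y by simp
    have "?L \<subseteq> {z, z'}"
    proof
      fix w assume "w \<in> ?L"
      then have "clique E (U - {w})" by (auto simp: almost_clique_at_def)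
      then show "w \<in> {z, z'}" using cliqueD[of E "U - {w}" z z'] zU z'(2) nonadj by blast
    qed
    then have "card ?L \<le> card {z, z'}" by (intro card_mono) auto
    also have "\<dots> \<le> card (U - {z, z'})"
      using U zU z'(2) by (subst card_Diff_subset) auto
    also have "\<dots> \<le> card ?R"
    proof (intro card_mono finR subsetI)
      fix x assume x: "x \<in> U - {z, z'}"
      have "cone_at U x"
        unfolding cone_at_def
      proof (intro conjI ballI)
        show "(x, w) \<in> E" if "w \<in> U - {x}" for w
          using that x zU z'(2) cliqueD[OF cl(1), of x w] cliqueD[OF cl(2), of x w] by blast
        show "\<not> clique E (U - {x})"
          using x zU z'(2) nonadj cliqueD[of E "U - {x}" z z'] by blast
      qed (use x in blast)
      moreover have "x \<in> \<Union>(cliques E r V)" using inX az x by blast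
      ultimately show "x \<in> ?R" by blast
    qed
    finally show ?thesis .
  qed
qed

text \<open>
  A clique containing \<open>z\<close> lies inside the closed neighbourhood of \<open>z\<close>. So a touching clique that is not
  inside avoids \<open>z\<close>, and adding \<open>z\<close> to it loses no information.
\<close>
lemma card_touching:
  assumes "finite V" "z \<in> V" "1 \<le> r"
  shows "card (touching E r V z) = card {S \<in> cliques E r V. S \<subseteq> closed_nbhd E V z}
    + card {U. U \<subseteq> V \<and> card U = Suc r \<and> almost_clique_at U z}"
proof -
  let ?In = "{S \<in> cliques E r V. S \<subseteq> closed_nbhd E V z}"
  let ?Out = "{S \<in> cliques E r V. S \<inter> closed_nbhd E V z \<noteq> {} \<and> \<not> S \<subseteq> closed_nbhd E V z}"
  let ?A = "{U. U \<subseteq> V \<and> card U = Suc r \<and> almost_clique_at U z}"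
  have ne: "S \<noteq> {}" if "S \<in> cliques E r V" for S
    using that assms by (auto simp: cliques_def)
  have "touching E r V z = ?In \<union> ?Out" using ne by (fastforce simp: touching_def)
  moreover have "?In \<inter> ?Out = {}" by auto
  moreover have "finite ?In" "finite ?Out" using finite_cliques[OF assms(1)] by auto
  ultimately have "card (touching E r V z) = card ?In + card ?Out"
    by (simp add: card_Un_disjoint)
  moreover have "bij_betw (insert z) ?Out ?A"
  proof (rule bij_betw_byWitness[where f' = "\<lambda>U. U - {z}"])
    have notin: "z \<notin> S" if "S \<in> ?Out" for S
      using that by (auto simp: cliques_def clique_def nbhd_def)
    show "\<forall>S\<in>?Out. insert z S - {z} = S" using notin by blast
    show "\<forall>U\<in>?A. insert z (U - {z}) = U" by (auto simp: almost_clique_at_def)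
    show "insert z ` ?Out \<subseteq> ?A"
    proof (rule image_subsetI)
      fix S assume S: "S \<in> ?Out"
      have nz: "z \<notin> S" using notin S by blast
      have "finite S" using S assms finite_subset by (auto simp: cliques_def)
      then show "insert z S \<in> ?A"
        using S nz assms by (auto simp: cliques_def almost_clique_at_def nbhd_def)
    qed
    show "(\<lambda>U. U - {z}) ` ?A \<subseteq> ?Out"
    proof (rule image_subsetI)
      fix U assume U: "U \<in> ?A"
      then obtain y where y: "y \<in> U" "(z, y) \<in> E" by (auto simp: almost_clique_at_def)
      moreover have "y \<noteq> z" using y by auto
      moreover have "y \<in> V" using y U by blast
      ultimately have "y \<in> (U - {z}) \<inter> closed_nbhd E V z" by (auto simp: nbhd_def)
      then show "U - {z} \<in> ?Out"
        using U by (auto simp: cliques_def almost_clique_at_def nbhd_def)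
    qed
  qed
  then have "card ?Out = card ?A" by (rule bij_betw_same_card)
  ultimately show ?thesis by simp
qed

text \<open>
  The \<open>r\<close>-subsets of the closed neighbourhood are cliques, non-cliques through \<open>z\<close>, or non-cliques
  avoiding \<open>z\<close>; the last ones become cones with apex \<open>z\<close>.
\<close>
lemma card_nbhd_subsets:
  assumes "finite V" "z \<in> V"
  shows "Suc (card (nbhd E V z)) choose r = card {S \<in> cliques E r V. S \<subseteq> closed_nbhd E V z}
    + card (defects E r V z) + card {U. U \<subseteq> V \<and> card U = Suc r \<and> cone_at U z}"
proof -
  let ?In = "{S \<in> cliques E r V. S \<subseteq> closed_nbhd E V z}"
  let ?Out = "{R. R \<subseteq> nbhd E V z \<and> card R = r \<and> \<not> clique E R}"
  let ?B = "{U. U \<subseteq> V \<and> card U = Suc r \<and> cone_at U z}"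
  have fin: "finite (closed_nbhd E V z)" using assms finite_nbhd by auto
  have sub: "closed_nbhd E V z \<subseteq> V" using assms by (auto simp: nbhd_def)
  have "{R. R \<subseteq> closed_nbhd E V z \<and> card R = r} = (?In \<union> defects E r V z) \<union> ?Out"
    using sub by (auto simp: cliques_def defects_def)
  moreover have "finite ?In" "finite (defects E r V z)" "finite ?Out"
    by (rule finite_subset[of _ "Pow (closed_nbhd E V z)"]; use fin in \<open>auto simp: defects_def\<close>)+
  moreover have "?In \<inter> defects E r V z = {}" "(?In \<union> defects E r V z) \<inter> ?Out = {}"
    by (auto simp: cliques_def defects_def nbhd_def)
  ultimately have "card {R. R \<subseteq> closed_nbhd E V z \<and> card R = r}
      = card ?In + card (defects E r V z) + card ?Out"
    by (simp add: card_Un_disjoint)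
  moreover have "bij_betw (insert z) ?Out ?B"
  proof (rule bij_betw_byWitness[where f' = "\<lambda>U. U - {z}"])
    show "\<forall>S\<in>?Out. insert z S - {z} = S" by (auto simp: nbhd_def)
    show "\<forall>U\<in>?B. insert z (U - {z}) = U" by (auto simp: cone_at_def)
    show "insert z ` ?Out \<subseteq> ?B"
    proof (rule image_subsetI)
      fix S assume S: "S \<in> ?Out"
      have nz: "z \<notin> S" using S by (auto simp: nbhd_def)
      have "finite S" using S finite_subset[OF _ finite_nbhd[OF assms(1)]] by auto
      then show "insert z S \<in> ?B"
        using S nz assms by (auto simp: cone_at_def nbhd_def)
    qed
    show "(\<lambda>U. U - {z}) ` ?B \<subseteq> ?Out"
      by (auto simp: cone_at_def nbhd_def)
  qed
  then have "card ?Out = card ?B" by (rule bij_betw_same_card)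
  ultimately show ?thesis
    using n_subsets[OF fin, of r] card_closed_nbhd[OF assms(1), of z] by simp
qed

text \<open>
  The averaging inequality. Summing over the vertices of \<open>r\<close>-cliques only, instead of over all
  vertices, is what later allows the other vertices to have arbitrary degree.
\<close>
lemma sum_touching_le:
  assumes "finite V" "3 \<le> r"
  shows "(\<Sum>z\<in>\<Union>(cliques E r V). card (touching E r V z) + card (defects E r V z))
    \<le> (\<Sum>z\<in>\<Union>(cliques E r V). Suc (card (nbhd E V z)) choose r)"
proof -
  let ?X = "\<Union>(cliques E r V)" and ?\<U> = "{U. U \<subseteq> V \<and> card U = Suc r}"
  have X: "?X \<subseteq> V" by (auto simp: cliques_def)
  then have finX: "finite ?X" using assms finite_subset by blast
  have finU: "finite ?\<U>" using assms by simp
  have "(\<Sum>z\<in>?X. card {U \<in> ?\<U>. almost_clique_at U z})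
      = (\<Sum>U\<in>?\<U>. card {z \<in> ?X. almost_clique_at U z})"
    by (rule sum_card_swap[OF finX finU])
  also have "\<dots> \<le> (\<Sum>U\<in>?\<U>. card {x \<in> ?X. cone_at U x})"
    using assms by (intro sum_mono almost_clique_le_cone) (auto intro: finite_subset)
  also have "\<dots> = (\<Sum>x\<in>?X. card {U \<in> ?\<U>. cone_at U x})"
    by (rule sum_card_swap[OF finX finU, symmetric])
  finally have main: "(\<Sum>z\<in>?X. card {U \<in> ?\<U>. almost_clique_at U z})
    \<le> (\<Sum>x\<in>?X. card {U \<in> ?\<U>. cone_at U x})" .
  have "(\<Sum>z\<in>?X. card (touching E r V z) + card (defects E r V z)) =
    (\<Sum>z\<in>?X. card {S \<in> cliques E r V. S \<subseteq> closed_nbhd E V z} + card (defects E r V z))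
    + (\<Sum>z\<in>?X. card {U \<in> ?\<U>. almost_clique_at U z})"
    unfolding sum.distrib[symmetric]
    by (rule sum.cong) (use assms X card_touching in auto)
  moreover have "(\<Sum>z\<in>?X. Suc (card (nbhd E V z)) choose r) =
    (\<Sum>z\<in>?X. card {S \<in> cliques E r V. S \<subseteq> closed_nbhd E V z} + card (defects E r V z))
    + (\<Sum>z\<in>?X. card {U \<in> ?\<U>. cone_at U z})"
    unfolding sum.distrib[symmetric]
    by (rule sum.cong) (use assms X card_nbhd_subsets in auto)
  ultimately show ?thesis using main by linarith
qed

end

section \<open>The bound under a degree condition, and the case of equality\<close>

text \<open>
  The shape of the extremal graphs, stated inside \<open>V\<close>: the members of \<open>P\<close> are the components \<open>K\<^sub>D\<close>, and
  what they leave over has \<open>card V mod D\<close> vertices.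
\<close>
definition clique_decomposition :: "'v rel \<Rightarrow> nat \<Rightarrow> nat \<Rightarrow> 'v set \<Rightarrow> 'v set set \<Rightarrow> bool" where
  "clique_decomposition E D r V P \<longleftrightarrow>
     (\<forall>C\<in>P. C \<subseteq> V \<and> card C = D \<and> clique E C \<and> E `` C \<inter> V \<subseteq> C) \<and> disjoint P \<and>
     card P = card V div D \<and> (r \<le> card V mod D \<longrightarrow> clique E (V - \<Union>P))"

context simple_graph
begin

lemma nbhd_large:
  assumes "finite V" "z \<in> \<Union>(cliques E r V)"
  shows "r \<le> Suc (card (nbhd E V z))"
proof -
  obtain S where S: "S \<in> cliques E r V" "z \<in> S" using assms by blast
  have "S \<subseteq> closed_nbhd E V z" using S by (auto simp: cliques_def nbhd_def clique_def)
  moreover have "finite (closed_nbhd E V z)" using assms by (simp add: finite_nbhd)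
  ultimately have "card S \<le> card (closed_nbhd E V z)" by (rule card_mono[rotated])
  then show ?thesis using S card_closed_nbhd[OF assms(1)] by (simp add: cliques_def)
qed

lemma closed_nbhd_subset: "z \<in> V \<Longrightarrow> closed_nbhd E V z \<subseteq> V"
  by (auto simp: nbhd_def)

lemma card_remove_closed_nbhd:
  assumes "finite V" "z \<in> V"
  shows "card (V - closed_nbhd E V z) = card V - Suc (card (nbhd E V z))"
proof -
  have "card (V - closed_nbhd E V z) = card V - card (closed_nbhd E V z)"
    using finite_nbhd[OF assms(1)] by (intro card_Diff_subset closed_nbhd_subset assms(2)) simp
  then show ?thesis by (simp add: card_closed_nbhd[OF assms(1)])
qed

lemma degree_hyp_subset:
  assumes V: "finite V" "W \<subseteq> V" and deg: "\<forall>z\<in>\<Union>(cliques E r V). card (nbhd E V z) < D"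
  shows "\<forall>z\<in>\<Union>(cliques E r W). card (nbhd E W z) < D"
proof
  fix z assume "z \<in> \<Union>(cliques E r W)"
  then have "card (nbhd E V z) < D" using deg cliques_mono[OF V(2), of E r] by blast
  moreover have "card (nbhd E W z) \<le> card (nbhd E V z)"
    using V by (intro card_mono) (auto simp: nbhd_def)
  ultimately show "card (nbhd E W z) < D" by linarith
qed

text \<open>
  By averaging some vertex of a clique, of degree \<open>d\<close> say, has at most \<open>Suc d choose r\<close> touching
  cliques. Deleting its closed neighbourhood keeps the degree condition, and the degree condition at
  this vertex makes the deleted block small enough for superadditivity of the bound.
\<close>
lemma card_cliques_le:
  assumes "finite V" "3 \<le> r" "\<forall>z\<in>\<Union>(cliques E r V). card (nbhd E V z) < D"
  shows "card (cliques E r V) \<le> clique_bound D r (card V)"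
  using assms
proof (induction "card V" arbitrary: V rule: less_induct)
  case less
  let ?X = "\<Union>(cliques E r V)"
  show ?case
  proof (cases "?X = {}")
    case True
    then have "cliques E r V \<subseteq> {{}}" by blast
    then have "cliques E r V = {}" using less.prems(2) by (auto simp: cliques_def)
    then show ?thesis by simp
  next
    case False
    have X: "?X \<subseteq> V" by (auto simp: cliques_def)
    then have finX: "finite ?X" using less.prems(1) by (rule finite_subset)
    have "\<exists>z\<in>?X. card (touching E r V z) \<le> Suc (card (nbhd E V z)) choose r"
    proof (rule ccontr)
      assume "\<not> ?thesis"
      then have "(\<Sum>z\<in>?X. Suc (card (nbhd E V z)) choose r) < (\<Sum>z\<in>?X. card (touching E r V z))"
        using False finX by (intro sum_strict_mono) (auto simp: not_le)
      then show False
        using sum_touching_le[OF less.prems(1,2)] by (simp add: sum.distrib)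
    qed
    then obtain z where z: "z \<in> ?X"
      and le: "card (touching E r V z) \<le> Suc (card (nbhd E V z)) choose r" by blast
    have zV: "z \<in> V" using X z by blast
    let ?W = "V - closed_nbhd E V z"
    have card_W: "card ?W = card V - Suc (card (nbhd E V z))"
      by (rule card_remove_closed_nbhd[OF less.prems(1) zV])
    have "Suc (card (nbhd E V z)) \<le> card V"
      using card_mono[OF less.prems(1) closed_nbhd_subset[OF zV]] card_closed_nbhd[OF less.prems(1)]
      by simp
    note le_V = this
    have "card (cliques E r ?W) \<le> clique_bound D r (card ?W)"
    proof (rule less.hyps)
      show "card ?W < card V" using card_W le_V by linarith
      show "\<forall>z\<in>\<Union>(cliques E r ?W). card (nbhd E ?W z) < D"
        by (rule degree_hyp_subset[OF less.prems(1) Diff_subset less.prems(3)])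
    qed (use less.prems(1,2) in simp_all)
    moreover have "(Suc (card (nbhd E V z)) choose r) + clique_bound D r (card V - Suc (card (nbhd E V z)))
      \<le> clique_bound D r (card V)"
    proof (rule clique_bound_superadditive)
      show "Suc (card (nbhd E V z)) \<le> D" using less.prems(3) z by (auto simp: Suc_le_eq)
    qed (use le_V less.prems(2) in simp_all)
    ultimately show ?thesis
      using le card_cliques_split[OF less.prems(1), of E r z] by (simp add: card_W)
  qed
qed

text \<open>
  Every vertex \<open>x\<close> of a clique could be used for the deletion, so a tight graph has at least
  \<open>Suc d choose r\<close> touching cliques at every such \<open>x\<close>, as otherwise the deletion would show that the
  bound is not attained; by averaging this is an equality everywhere and no defects exist. Two
  nonadjacent points of the closed neighbourhood would, together with \<open>z\<close>, extend to a defect. The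
  equality at \<open>z\<close> also leaves a tight graph after the deletion and an equality in the superadditivity
  of the bound.
\<close>
lemma closed_nbhd_of_tight:
  assumes V: "finite V" "3 \<le> r" "\<forall>z\<in>\<Union>(cliques E r V). card (nbhd E V z) < D"
    and tight: "card (cliques E r V) = clique_bound D r (card V)"
    and z: "z \<in> \<Union>(cliques E r V)"
  shows "clique E (closed_nbhd E V z)"
    and "card (cliques E r (V - closed_nbhd E V z)) = clique_bound D r (card (V - closed_nbhd E V z))"
    and "card (closed_nbhd E V z) = D \<or> card (closed_nbhd E V z) = card V mod D"
proof -
  let ?X = "\<Union>(cliques E r V)" and ?d = "\<lambda>x. card (nbhd E V x)"
  have X: "?X \<subseteq> V" by (auto simp: cliques_def)
  then have finX: "finite ?X" using V(1) by (rule finite_subset)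
  have le_V: "Suc (?d x) \<le> card V" if "x \<in> V" for x
    using card_mono[OF V(1) closed_nbhd_subset[OF that]] card_closed_nbhd[OF V(1)] by simp
  have rest: "card (cliques E r (V - closed_nbhd E V x)) \<le> clique_bound D r (card V - Suc (?d x))"
    if "x \<in> V" for x
    using card_cliques_le[OF _ V(2) degree_hyp_subset[OF V(1) Diff_subset V(3)], of "closed_nbhd E V x"]
      V(1) card_remove_closed_nbhd[OF V(1) that] by simp
  have super: "(Suc (?d x) choose r) + clique_bound D r (card V - Suc (?d x)) \<le> clique_bound D r (card V)"
    if "x \<in> ?X" for x
  proof (rule clique_bound_superadditive)
    show "Suc (?d x) \<le> D" using V(3) that by (auto simp: Suc_le_eq)
    show "Suc (?d x) \<le> card V" using le_V that X by blast
    show "1 \<le> r" using V(2) by simp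
  qed
  have ge: "Suc (?d x) choose r \<le> card (touching E r V x)" if "x \<in> ?X" for x
  proof -
    have "x \<in> V" using that X by blast
    then show ?thesis
      using rest[of x] super[OF that] card_cliques_split[OF V(1), of E r x] tight by linarith
  qed
  have no_defect: "card (touching E r V x) + card (defects E r V x) = Suc (?d x) choose r"
    if "x \<in> ?X" for x
  proof (rule ccontr)
    assume "\<not> ?thesis"
    then have "Suc (?d x) choose r < card (touching E r V x) + card (defects E r V x)"
      using ge[OF that] by linarith
    then have "(\<Sum>x\<in>?X. Suc (?d x) choose r)
        < (\<Sum>x\<in>?X. card (touching E r V x) + card (defects E r V x))"
      using that by (intro sum_strict_mono_ex1 finX ballI trans_le_add1 ge) blast+
    then show False using sum_touching_le[OF V(1,2)] by linarith
  qed
  have zV: "z \<in> V" using X z by blast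
  have "card (defects E r V z) = 0" using no_defect[OF z] ge[OF z] by linarith
  moreover have "finite (defects E r V z)"
    by (rule finite_subset[of _ "Pow (closed_nbhd E V z)"]) (use V in \<open>auto simp: defects_def finite_nbhd\<close>)
  ultimately have nodef: "defects E r V z = {}" by simp
  show "clique E (closed_nbhd E V z)"
  proof (rule ccontr)
    assume "\<not> ?thesis"
    then obtain a b where ab: "a \<in> closed_nbhd E V z" "b \<in> closed_nbhd E V z" "a \<noteq> b" "(a, b) \<notin> E"
      by (auto simp: clique_def)
    have "card {z, a, b} \<le> r" using V(2) by (simp add: card_insert_if)
    moreover have "r \<le> card (closed_nbhd E V z)"
      using nbhd_large[OF V(1) z] card_closed_nbhd[OF V(1)] by simp
    ultimately obtain R where "{z, a, b} \<subseteq> R" "R \<subseteq> closed_nbhd E V z" "card R = r"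
      using exists_subset_between[of "{z, a, b}" r "closed_nbhd E V z"] ab finite_nbhd[OF V(1)] by auto
    then have "R \<in> defects E r V z" using ab by (auto simp: defects_def clique_def)
    then show False using nodef by blast
  qed
  have "card (touching E r V z) = Suc (?d z) choose r" using no_defect[OF z] ge[OF z] by linarith
  then have eq: "(Suc (?d z) choose r) + card (cliques E r (V - closed_nbhd E V z))
      = clique_bound D r (card V)"
    using tight card_cliques_split[OF V(1), of E r z] by simp
  then have rest_eq: "card (cliques E r (V - closed_nbhd E V z)) = clique_bound D r (card V - Suc (?d z))"
    using rest[OF zV] super[OF z] by linarith
  then show "card (cliques E r (V - closed_nbhd E V z)) = clique_bound D r (card (V - closed_nbhd E V z))"
    using card_remove_closed_nbhd[OF V(1) zV] by simp
  have "Suc (?d z) = D \<or> Suc (?d z) = card V mod D"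
  proof (rule clique_bound_additive_only)
    show "Suc (?d z) \<le> D" using V(3) z by (auto simp: Suc_le_eq)
    show "r \<le> Suc (?d z)" by (rule nbhd_large[OF V(1) z])
    show "(Suc (?d z) choose r) + clique_bound D r (card V - Suc (?d z)) = clique_bound D r (card V)"
      using eq rest_eq by simp
  qed (use V(2) le_V[OF zV] in simp_all)
  then show "card (closed_nbhd E V z) = D \<or> card (closed_nbhd E V z) = card V mod D"
    using card_closed_nbhd[OF V(1)] by simp
qed

text \<open>
  The closed neighbourhood of \<open>z\<close> is a clique on at least \<open>r\<close> vertices, so each of its members \<open>w\<close>
  lies in an \<open>r\<close>-clique and has itself a clique as closed neighbourhood. This contains \<open>z\<close>, so no
  neighbour of \<open>w\<close> is outside the closed neighbourhood of \<open>z\<close>.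
\<close>
lemma closed_nbhd_isolated:
  assumes V: "finite V" "3 \<le> r" "\<forall>z\<in>\<Union>(cliques E r V). card (nbhd E V z) < D"
    and tight: "card (cliques E r V) = clique_bound D r (card V)"
    and z: "z \<in> \<Union>(cliques E r V)"
  shows "E `` closed_nbhd E V z \<inter> V \<subseteq> closed_nbhd E V z"
proof
  fix y assume "y \<in> E `` closed_nbhd E V z \<inter> V"
  then obtain w where w: "w \<in> closed_nbhd E V z" "(w, y) \<in> E" and y: "y \<in> V" by blast
  have cz: "clique E (closed_nbhd E V z)" by (rule closed_nbhd_of_tight(1)[OF assms])
  obtain R where R: "w \<in> R" "R \<subseteq> closed_nbhd E V z" "card R = r"
  proof -
    have "card {w} \<le> r" using V(2) by simp
    moreover have "r \<le> card (closed_nbhd E V z)"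
      using nbhd_large[OF V(1) z] card_closed_nbhd[OF V(1)] by simp
    ultimately show ?thesis
      using that exists_subset_between[of "{w}" r "closed_nbhd E V z"] w(1) finite_nbhd[OF V(1)]
      by auto
  qed
  have zV: "z \<in> V" using z by (auto simp: cliques_def)
  have "R \<in> cliques E r V"
    using R clique_subset[OF cz] closed_nbhd_subset[OF zV] by (auto simp: cliques_def)
  then have "clique E (closed_nbhd E V w)"
    using R closed_nbhd_of_tight(1)[OF V tight, of w] by blast
  moreover have "z \<in> closed_nbhd E V w" using w zV E_sym by (auto simp: nbhd_def)
  moreover have "y \<in> closed_nbhd E V w" using w y by (auto simp: nbhd_def)
  ultimately have "y = z \<or> (z, y) \<in> E" by (auto simp: clique_def)
  then show "y \<in> closed_nbhd E V z" using y by (auto simp: nbhd_def)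
qed

lemma card_rest_of_clique_decomposition:
  assumes V: "finite V" and P: "clique_decomposition E D r V P"
  shows "finite P" and "card (V - \<Union>P) = card V mod D"
proof -
  show "finite P"
    by (rule finite_subset[of _ "Pow V"]) (use V P in \<open>auto simp: clique_decomposition_def\<close>)
  have sub: "\<Union>P \<subseteq> V" using P by (auto simp: clique_decomposition_def)
  have "card (\<Union>P) = (\<Sum>C\<in>P. card C)"
    by (rule card_Union_disjoint)
       (use P finite_subset[OF _ V] in \<open>auto simp: clique_decomposition_def\<close>)
  also have "\<dots> = (\<Sum>C\<in>P. D)" using P by (intro sum.cong) (auto simp: clique_decomposition_def)
  also have "\<dots> = D * (card V div D)" using P by (simp add: clique_decomposition_def)
  finally show "card (V - \<Union>P) = card V mod D"
    using sub finite_subset[OF sub V] by (simp add: card_Diff_subset minus_mult_div_eq_mod)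
qed

text \<open>
  The component split off has size \<open>D\<close> or \<open>card V mod D\<close>. In the first case it is added to the
  decomposition of the remaining graph. In the second case the remaining graph has a multiple of
  \<open>D\<close> vertices and is exhausted by its \<open>K\<^sub>D\<close> components, so that the component becomes the rest.
\<close>
lemma tight_imp_clique_decomposition:
  assumes "finite V" "3 \<le> r" "r \<le> D" "\<forall>z\<in>\<Union>(cliques E r V). card (nbhd E V z) < D"
    and "card (cliques E r V) = clique_bound D r (card V)"
  shows "\<exists>P. clique_decomposition E D r V P"
  using assms
proof (induction "card V" arbitrary: V rule: less_induct)
  case less
  let ?X = "\<Union>(cliques E r V)"
  have D: "0 < D" using less.prems by linarith
  show ?case
  proof (cases "?X = {}")
    case True
    then have "cliques E r V \<subseteq> {{}}" by blast
    then have "cliques E r V = {}" using less.prems(2) by (auto simp: cliques_def)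
    then have "card V div D * (D choose r) = 0" "card V mod D choose r = 0"
      using less.prems(5) by (simp_all add: clique_bound_def)
    then have "card V div D = 0" "card V mod D < r"
      using less.prems(3) by (auto simp: binomial_eq_0_iff)
    then have "clique_decomposition E D r V {}"
      by (auto simp: clique_decomposition_def disjoint_def)
    then show ?thesis by blast
  next
    case False
    then obtain z where z: "z \<in> ?X" by blast
    then have zV: "z \<in> V" by (auto simp: cliques_def)
    let ?N = "closed_nbhd E V z"
    let ?W = "V - ?N"
    note tight = closed_nbhd_of_tight[OF less.prems(1,2,4,5) z]
    have iso: "E `` ?N \<inter> V \<subseteq> ?N" by (rule closed_nbhd_isolated[OF less.prems(1,2,4,5) z])
    have NV: "?N \<subseteq> V" by (rule closed_nbhd_subset[OF zV])
    have finN: "finite ?N" by (rule finite_subset[OF NV less.prems(1)])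
    have cardN: "card ?N \<le> card V" "0 < card ?N"
      using card_mono[OF less.prems(1) NV] finN by (auto simp: card_gt_0_iff)
    have cardW: "card ?W = card V - card ?N" using card_Diff_subset[OF finN NV] .
    have "\<exists>P. clique_decomposition E D r ?W P"
    proof (rule less.hyps)
      show "card ?W < card V" using cardN cardW by linarith
      show "\<forall>z\<in>\<Union>(cliques E r ?W). card (nbhd E ?W z) < D"
        by (rule degree_hyp_subset[OF less.prems(1) Diff_subset less.prems(4)])
    qed (use less.prems(1-3) tight(2) in simp_all)
    then obtain P where P: "clique_decomposition E D r ?W P" by blast
    have PW: "\<Union>P \<subseteq> ?W" using P by (auto simp: clique_decomposition_def)
    have finP: "finite P"
      by (rule finite_subset[of _ "Pow V"]) (use P less.prems(1) in \<open>auto simp: clique_decomposition_def\<close>)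
    have isoP: "E `` C \<inter> V \<subseteq> C" if "C \<in> P" for C
    proof
      fix y assume y: "y \<in> E `` C \<inter> V"
      then obtain c where c: "c \<in> C" "(c, y) \<in> E" "y \<in> V" by blast
      have cW: "c \<in> ?W" using c that PW by blast
      have "y \<notin> ?N" using iso E_sym[OF c(2)] cW by blast
      then show "y \<in> C" using c that P by (auto simp: clique_decomposition_def)
    qed
    show ?thesis
    proof (cases "card ?N = D")
      case True
      have "clique_decomposition E D r V (insert ?N P)"
        unfolding clique_decomposition_def
      proof (intro conjI ballI)
        fix C assume "C \<in> insert ?N P"
        then consider "C = ?N" | "C \<in> P" by blast
        then show "C \<subseteq> V" "card C = D" "clique E C" "E `` C \<inter> V \<subseteq> C"
          by (cases; use P NV True tight(1) iso isoP in \<open>auto simp: clique_decomposition_def\<close>)+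
      next
        show "disjoint (insert ?N P)"
          using P PW by (auto simp: clique_decomposition_def disjoint_def)
        have "?N \<notin> P" using PW by blast
        then show "card (insert ?N P) = card V div D"
          using finP P cardW True cardN D
          by (simp add: clique_decomposition_def le_div_geq)
        have "card V mod D = card ?W mod D" using cardW True cardN by (simp add: le_mod_geq)
        moreover have "V - \<Union>(insert ?N P) = ?W - \<Union>P" by blast
        ultimately show "r \<le> card V mod D \<longrightarrow> clique E (V - \<Union>(insert ?N P))"
          using P by (simp add: clique_decomposition_def)
      qed
      then show ?thesis by blast
    next
      case False
      then have N: "card ?N = card V mod D" using tight(3) by blast
      then have W: "card ?W = D * (card V div D)" using cardW mult_div_mod_eq[of D "card V"] by linarith
      have "card P = card V div D" using P W D by (simp add: clique_decomposition_def)
      \<comment> \<open>Here the blocks of \<open>P\<close> use up all of \<open>?W\<close>, as its size is a multiple of \<open>D\<close>.\<close>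
      have "card (?W - \<Union>P) = card ?W mod D"
        using less.prems(1) by (intro card_rest_of_clique_decomposition(2)[OF _ P]) simp
      then have "card (?W - \<Union>P) = 0" using W by simp
      then have "?W - \<Union>P = {}" using less.prems(1) by simp
      then have "\<Union>P = ?W" using PW by blast
      then have "V - \<Union>P = ?N" using NV by blast
      then have "clique_decomposition E D r V P"
        using P PW isoP tight(1) \<open>card P = card V div D\<close> by (auto simp: clique_decomposition_def)
      then show ?thesis by blast
    qed
  qed
qed

lemma card_cliques_of_clique:
  assumes "finite C" "clique E C"
  shows "card (cliques E r C) = card C choose r"
proof -
  have "cliques E r C = {S. S \<subseteq> C \<and> card S = r}"
    using assms by (auto simp: cliques_def intro: clique_subset)
  then show ?thesis using n_subsets[OF assms(1)] by simp
qed

lemma card_cliques_of_clique_decomposition: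
  assumes V: "finite V" "1 \<le> r" and P: "clique_decomposition E D r V P"
  shows "card (cliques E r V) = clique_bound D r (card V)"
proof -
  let ?B = "V - \<Union>P"
  note rest = card_rest_of_clique_decomposition[OF V(1) P]
  have C: "C \<subseteq> V" "card C = D" "clique E C" "E `` C \<inter> V \<subseteq> C" "finite C" if "C \<in> P" for C
    using P that finite_subset[OF _ V(1)] by (auto simp: clique_decomposition_def)
  have ne: "S \<noteq> {}" if "S \<in> cliques E r W" for S W
    using that V by (auto simp: cliques_def)
  have "cliques E r V = (\<Union>C\<in>P. cliques E r C) \<union> cliques E r ?B"
  proof (intro equalityI subsetI)
    fix S assume S: "S \<in> cliques E r V"
    show "S \<in> (\<Union>C\<in>P. cliques E r C) \<union> cliques E r ?B"
    proof (cases "S \<subseteq> ?B")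
      case False
      then obtain c K where K: "c \<in> S" "c \<in> K" "K \<in> P" using S by (auto simp: cliques_def)
      have "S \<subseteq> K"
      proof
        fix y assume "y \<in> S"
        then show "y \<in> K"
          using K S C(4)[OF K(3)] cliqueD[of E S c y] by (cases "y = c") (auto simp: cliques_def)
      qed
      then show ?thesis using S K by (auto simp: cliques_def)
    qed (use S in \<open>auto simp: cliques_def\<close>)
  next
    fix S assume "S \<in> (\<Union>C\<in>P. cliques E r C) \<union> cliques E r ?B"
    then show "S \<in> cliques E r V" using C(1) by (auto simp: cliques_def)
  qed
  moreover have "(\<Union>C\<in>P. cliques E r C) \<inter> cliques E r ?B = {}"
  proof (rule ccontr)
    assume "\<not> ?thesis"
    then obtain S K where "S \<in> cliques E r K" "K \<in> P" "S \<in> cliques E r ?B" by blast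
    then show False using ne by (fastforce simp: cliques_def)
  qed
  moreover have "finite (\<Union>C\<in>P. cliques E r C)" using rest(1) C(5) by (auto intro: finite_cliques)
  moreover have "finite (cliques E r ?B)" using V by (auto intro: finite_cliques)
  ultimately have "card (cliques E r V) = card (\<Union>C\<in>P. cliques E r C) + card (cliques E r ?B)"
    by (simp add: card_Un_disjoint)
  also have "card (\<Union>C\<in>P. cliques E r C) = (\<Sum>C\<in>P. card (cliques E r C))"
  proof (rule card_UN_disjoint[OF rest(1)])
    show "\<forall>C\<in>P. finite (cliques E r C)" using C(5) by (auto intro: finite_cliques)
    show "\<forall>C\<in>P. \<forall>K\<in>P. C \<noteq> K \<longrightarrow> cliques E r C \<inter> cliques E r K = {}"
    proof (intro ballI impI, rule ccontr)
      fix C K assume *: "C \<in> P" "K \<in> P" "C \<noteq> K" "cliques E r C \<inter> cliques E r K \<noteq> {}"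
      then obtain S where S: "S \<in> cliques E r C" "S \<in> cliques E r K" by blast
      have "C \<inter> K = {}" using * P by (auto simp: clique_decomposition_def disjoint_def)
      then show False using S ne[OF S(1)] by (auto simp: cliques_def)
    qed
  qed
  also have "\<dots> = (\<Sum>C\<in>P. D choose r)"
    using C card_cliques_of_clique by (intro sum.cong) auto
  also have "\<dots> = (card V div D) * (D choose r)" using P by (simp add: clique_decomposition_def)
  also have "card (cliques E r ?B) = card V mod D choose r"
  proof (cases "r \<le> card V mod D")
    case True
    then show ?thesis
      using P V rest(2) card_cliques_of_clique[of ?B r] by (simp add: clique_decomposition_def)
  next
    case False
    have "card S \<le> card ?B" if "S \<subseteq> ?B" for S using that V by (intro card_mono) auto
    then have "cliques E r ?B = {}" using False rest(2) by (fastforce simp: cliques_def)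
    then show ?thesis using False by (simp add: binomial_eq_0)
  qed
  finally show ?thesis by (simp add: clique_bound_def)
qed

end

section \<open>Copies and freeness in terms of injective maps\<close>

lemma pair_graph_simple: "pair_graph G \<Longrightarrow> simple_graph (parcs G)"
proof
  assume "pair_graph G"
  then interpret pair_graph G .
  show "sym (parcs G)" using pair_sym_arcs by (simp add: symmetric_def)
  show "irrefl (parcs G)" using pair_no_loops by (force simp: irrefl_def)
qed

lemma pair_graphI:
  assumes "finite (pverts G)" "parcs G \<subseteq> pverts G \<times> pverts G" "sym (parcs G)" "irrefl (parcs G)"
  shows "pair_graph G"
proof
  show "finite (parcs G)" using assms by (meson finite_SigmaI finite_subset)
  show "symmetric (with_proj G)" using assms by (simp add: symmetric_def)
  show "fst e \<noteq> snd e" if "e \<in> parcs G" for e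
    using that assms by (cases e) (auto simp: irrefl_def)
qed (use assms in auto)

lemma pair_wf_parcs: "pair_wf_digraph G \<Longrightarrow> parcs G \<subseteq> pverts G \<times> pverts G"
  by (auto simp: pair_wf_digraph_def)

text \<open>
  An isomorphism of the underlying digraphs also carries a map on arcs and new incidence functions.
  Between graphs whose arcs are pairs all of this is determined by the map on vertices, so that
  isomorphic copies are exactly the images under injective maps.
\<close>
definition image_graph :: "('a \<Rightarrow> 'b) \<Rightarrow> 'a pair_pre_digraph \<Rightarrow> 'b pair_pre_digraph" where
  "image_graph f G = \<lparr> pverts = f ` pverts G, parcs = map_prod f f ` parcs G \<rparr>"

lemma wf_with_proj_iff: "wf_digraph (with_proj G) \<longleftrightarrow> pair_wf_digraph G"
  by (auto simp: wf_digraph_def pair_wf_digraph_def)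

lemma digraph_iso_iff_image:
  assumes "pair_wf_digraph G" and proj: "tail S = fst" "head S = snd"
  shows "digraph_iso (with_proj G) S \<longleftrightarrow>
    (\<exists>f. inj_on f (pverts G) \<and> S = with_proj (image_graph f G))"
proof
  assume "digraph_iso (with_proj G) S"
  then obtain h where h: "pre_digraph.digraph_isomorphism (with_proj G) h"
    and S: "S = app_iso h (with_proj G)" by (auto simp: digraph_iso_def)
  let ?f = "iso_verts h"
  have tl: "iso_tail h = fst" "iso_head h = snd" using proj S by auto
  have inj: "inj_on ?f (pverts G)" using h by (simp add: pre_digraph.digraph_isomorphism_def)
  have "iso_arcs h a = map_prod ?f ?f a" if "a \<in> parcs G" for a
    using h that by (cases a) (auto simp: pre_digraph.digraph_isomorphism_def tl prod_eq_iff)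
  then have "iso_arcs h ` parcs G = map_prod ?f ?f ` parcs G" by (rule image_cong[OF refl])
  then have "S = with_proj (image_graph ?f G)"
    unfolding S by (simp add: app_iso_def with_proj_def image_graph_def tl)
  then show "\<exists>f. inj_on f (pverts G) \<and> S = with_proj (image_graph f G)" using inj by blast
next
  assume "\<exists>f. inj_on f (pverts G) \<and> S = with_proj (image_graph f G)"
  then obtain f where f: "inj_on f (pverts G)" and S: "S = with_proj (image_graph f G)" by blast
  let ?h = "\<lparr> iso_verts = f, iso_arcs = map_prod f f, iso_head = snd, iso_tail = fst \<rparr>"
  have sub: "parcs G \<subseteq> pverts G \<times> pverts G" using assms(1) by (rule pair_wf_parcs)
  have "inj_on (map_prod f f) (parcs G)"
    by (rule inj_on_subset[OF map_prod_inj_on[OF f f] sub])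
  then have "pre_digraph.digraph_isomorphism (with_proj G) ?h"
    using f assms(1) by (auto simp: pre_digraph.digraph_isomorphism_def wf_with_proj_iff)
  moreover have "S = app_iso ?h (with_proj G)"
    unfolding S by (simp add: app_iso_def with_proj_def image_graph_def)
  ultimately show "digraph_iso (with_proj G) S" by (auto simp: digraph_iso_def)
qed

lemma with_proj_eq_iff: "with_proj G = with_proj H \<longleftrightarrow> G = H"
  by (cases G; cases H) (auto simp: with_proj_def)

lemma digraph_iso_pair_iff:
  "digraph_iso (with_proj G) (with_proj H) \<longleftrightarrow>
    pair_wf_digraph G \<and> (\<exists>f. inj_on f (pverts G) \<and> H = image_graph f G)"
proof (cases "pair_wf_digraph G")
  case True
  then show ?thesis using digraph_iso_iff_image[of G "with_proj H"] by (simp add: with_proj_eq_iff)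
next
  case False
  then show ?thesis
    by (simp add: digraph_iso_def pre_digraph.digraph_isomorphism_def wf_with_proj_iff)
qed

lemma copies_eq:
  assumes "pair_wf_digraph H" "pair_wf_digraph G"
  shows "copies H G = {with_proj (image_graph f H) | f. inj_on f (pverts H) \<and>
    f ` pverts H \<subseteq> pverts G \<and> map_prod f f ` parcs H \<subseteq> parcs G}"
proof (intro equalityI subsetI)
  fix S assume "S \<in> copies H G"
  then have S: "subgraph S (with_proj G)" "digraph_iso (with_proj H) S" by (auto simp: copies_def)
  then have "tail S = fst" "head S = snd" by (auto simp: subgraph_def compatible_def)
  then obtain f where f: "inj_on f (pverts H)" "S = with_proj (image_graph f H)"
    using S(2) digraph_iso_iff_image[OF assms(1)] by blast
  then show "S \<in> {with_proj (image_graph f H) | f. inj_on f (pverts H) \<and>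
    f ` pverts H \<subseteq> pverts G \<and> map_prod f f ` parcs H \<subseteq> parcs G}"
    using S(1) by (auto simp: subgraph_def image_graph_def)
next
  fix S assume "S \<in> {with_proj (image_graph f H) | f. inj_on f (pverts H) \<and>
    f ` pverts H \<subseteq> pverts G \<and> map_prod f f ` parcs H \<subseteq> parcs G}"
  then obtain f where f: "inj_on f (pverts H)" "f ` pverts H \<subseteq> pverts G"
    "map_prod f f ` parcs H \<subseteq> parcs G" and S: "S = with_proj (image_graph f H)" by blast
  have "pair_wf_digraph (image_graph f H)"
    using pair_wf_parcs[OF assms(1)] by (auto simp: pair_wf_digraph_def image_graph_def)
  then have "subgraph S (with_proj G)"
    using f assms(2) unfolding S
    by (auto simp: subgraph_def compatible_def wf_with_proj_iff image_graph_def)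
  moreover have "digraph_iso (with_proj H) S"
    using f(1) S digraph_iso_iff_image[OF assms(1), of S] by auto
  ultimately show "S \<in> copies H G" by (simp add: copies_def)
qed

lemma is_free_iff:
  assumes "pair_wf_digraph F" "pair_wf_digraph G"
  shows "is_free F G \<longleftrightarrow> \<not> (\<exists>f. inj_on f (pverts F) \<and> f ` pverts F \<subseteq> pverts G \<and>
    map_prod f f ` parcs F \<subseteq> parcs G)"
  unfolding is_free_def copies_eq[OF assms] by blast

lemma pair_graph_complete_graph: "pair_graph (complete_graph m)"
  by (rule pair_graphI) (auto simp: complete_graph_def sym_def irrefl_def)

lemma pair_graph_wf: "pair_graph G \<Longrightarrow> pair_wf_digraph G"
  by (simp add: pair_graph_def pair_digraph_def pair_fin_digraph_def)

lemma pair_graph_finite: "pair_graph G \<Longrightarrow> finite (pverts G)"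
  by (simp add: pair_graph_def pair_digraph_def pair_fin_digraph_def pair_fin_digraph_axioms_def)

lemma card_copies_complete_graph:
  assumes G: "pair_graph G"
  shows "card (copies (complete_graph r) G) = card (cliques (parcs G) r (pverts G))"
proof -
  define K where "K = (\<lambda>S. with_proj \<lparr> pverts = S, parcs = {(u, v). u \<in> S \<and> v \<in> S \<and> u \<noteq> v} \<rparr>
    :: ('a, 'a \<times> 'a) pre_digraph)"
  have img: "with_proj (image_graph f (complete_graph r)) = K (f ` {..<r})" if "inj_on f {..<r}" for f
  proof -
    have "map_prod f f ` {(u, v). u < r \<and> v < r \<and> u \<noteq> v} =
      {(u, v). u \<in> f ` {..<r} \<and> v \<in> f ` {..<r} \<and> u \<noteq> v}"
      using that by (force simp: inj_on_def)
    then show ?thesis by (simp add: K_def image_graph_def complete_graph_def)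
  qed
  \<comment> \<open>A copy of \<open>K\<^sub>r\<close> is determined by its vertex set, through \<open>K\<close>.\<close>
  have "copies (complete_graph r) G = K ` cliques (parcs G) r (pverts G)"
  proof (intro equalityI subsetI)
    fix S assume "S \<in> copies (complete_graph r) G"
    then obtain f where f: "inj_on f {..<r}" "f ` {..<r} \<subseteq> pverts G"
      "map_prod f f ` parcs (complete_graph r) \<subseteq> parcs G" "S = with_proj (image_graph f (complete_graph r))"
      using copies_eq[OF pair_graph_wf[OF pair_graph_complete_graph] pair_graph_wf[OF G], of r]
      by (auto simp: complete_graph_def)
    have "(f u, f v) \<in> parcs G" if "u < r" "v < r" "u \<noteq> v" for u v
      using f(3) that by (force simp: complete_graph_def)
    then have "clique (parcs G) (f ` {..<r})" by (auto simp: clique_def)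
    then have "f ` {..<r} \<in> cliques (parcs G) r (pverts G)"
      using f by (simp add: cliques_def card_image)
    then show "S \<in> K ` cliques (parcs G) r (pverts G)" using img[OF f(1)] f(4) by blast
  next
    fix S assume "S \<in> K ` cliques (parcs G) r (pverts G)"
    then obtain C where C: "C \<in> cliques (parcs G) r (pverts G)" "S = K C" by blast
    have "finite C" using C finite_subset[OF _ pair_graph_finite[OF G]] by (auto simp: cliques_def)
    then obtain f where f: "bij_betw f {..<r} C"
      using C by (metis (mono_tags, lifting) bij_betw_iff_card card_lessThan cliques_def finite_lessThan mem_Collect_eq)
    then have inj: "inj_on f {..<r}" and im: "f ` {..<r} = C" by (auto simp: bij_betw_def)
    have "map_prod f f ` parcs (complete_graph r) \<subseteq> parcs G"
    proof
      fix a assume "a \<in> map_prod f f ` parcs (complete_graph r)"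
      then obtain u v where uv: "a = (f u, f v)" "u < r" "v < r" "u \<noteq> v" by (auto simp: complete_graph_def)
      have "f u \<noteq> f v" using inj uv by (auto simp: inj_on_def)
      then show "a \<in> parcs G"
        using uv C im cliqueD[of "parcs G" C "f u" "f v"] by (auto simp: cliques_def)
    qed
    moreover have "S = with_proj (image_graph f (complete_graph r))" using img[OF inj] im C by simp
    ultimately show "S \<in> copies (complete_graph r) G"
      using copies_eq[OF pair_graph_wf[OF pair_graph_complete_graph] pair_graph_wf[OF G], of r] inj im C
      by (auto simp: complete_graph_def cliques_def)
  qed
  moreover have "inj_on K (cliques (parcs G) r (pverts G))"
    by (rule inj_on_inverseI[where g = verts]) (simp add: K_def)
  ultimately show ?thesis by (simp add: card_image)
qed

section \<open>Tree-free graphs\<close>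

text \<open>
  If \<open>z\<close> had \<open>t - 1\<close> neighbours, at most \<open>r - 1\<close> of them would lie in the clique \<open>S\<close> through \<open>z\<close>, so \<open>t - r\<close>
  remain for the leaves; the other \<open>r\<close> vertices of \<open>T\<close> go to \<open>S\<close>, where every edge is available.
\<close>
lemma free_imp_degree_lt:
  assumes T: "pair_graph T" "card (pverts T) = t" and r: "1 \<le> r" "r \<le> t - 1"
    and p: "p \<in> pverts T" "t - r \<le>
      card {v \<in> pverts T. (p, v) \<in> parcs T \<and> out_degree (with_proj T) v = 1}"
    and G: "pair_graph G" and free: "is_free T G"
    and z: "z \<in> \<Union>(cliques (parcs G) r (pverts G))"
  shows "card (nbhd (parcs G) (pverts G) z) < t - 1"
proof (rule ccontr)
  assume "\<not> ?thesis"
  then have deg: "t - 1 \<le> card (nbhd (parcs G) (pverts G) z)" by simp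
  let ?N = "nbhd (parcs G) (pverts G) z"
  interpret T: simple_graph "parcs T" by (rule pair_graph_simple[OF T(1)])
  interpret G: simple_graph "parcs G" by (rule pair_graph_simple[OF G])
  have finT: "finite (pverts T)" by (rule pair_graph_finite[OF T(1)])
  have finN: "finite ?N" by (rule finite_nbhd[OF pair_graph_finite[OF G]])
  obtain S where S: "S \<subseteq> pverts G" "card S = r" "clique (parcs G) S" "z \<in> S"
    using z by (auto simp: cliques_def)
  have finS: "finite S" by (rule finite_subset[OF S(1) pair_graph_finite[OF G]])
  obtain L where L: "L \<subseteq> {v \<in> pverts T. (p, v) \<in> parcs T \<and> out_degree (with_proj T) v = 1}"
    "card L = t - r" "finite L"
    using obtain_subset_with_card_n[OF p(2)] by blast
  have "p \<notin> L" using L(1) by auto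
  have leaf: "w = p" if "v \<in> L" "(v, w) \<in> parcs T" for v w
  proof -
    have "card (out_arcs (with_proj T) v) = 1" using L(1) that by (auto simp: out_degree_def)
    then obtain a where "out_arcs (with_proj T) v = {a}" by (auto simp: card_1_singleton_iff)
    moreover have "(v, p) \<in> out_arcs (with_proj T) v" using L(1) that T.E_sym by auto
    moreover have "(v, w) \<in> out_arcs (with_proj T) v" using that by auto
    ultimately show ?thesis by auto
  qed
  have "card (?N \<inter> S) \<le> card (S - {z})" using finS by (intro card_mono) (auto simp: nbhd_def)
  then have "card (?N \<inter> S) \<le> r - 1" using S finS by simp
  then have "card L \<le> card (?N - S)" using deg L(2) r finN by (simp add: card_Diff_subset_Int)
  then obtain h where h: "h ` L \<subseteq> ?N - S" "inj_on h L"
    using card_le_inj[OF L(3), of "?N - S"] finN by auto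
  have "card (pverts T - L - {p}) = card (S - {z})"
  proof -
    have "L \<subseteq> pverts T" using L(1) by blast
    then have "card (pverts T - L) = t - card L" using T(2) L(3) by (simp add: card_Diff_subset)
    moreover have "p \<in> pverts T - L" using p(1) \<open>p \<notin> L\<close> by blast
    ultimately have "card (pverts T - L - {p}) = r - 1"
      using L(2) r by (simp add: card_Diff_singleton)
    then show ?thesis using S(2,4) by (simp add: card_Diff_singleton)
  qed
  then obtain g where g: "bij_betw g (pverts T - L - {p}) (S - {z})"
    using finite_same_card_bij[of "pverts T - L - {p}" "S - {z}"] finT finS by auto
  \<comment> \<open>The parent goes to \<open>z\<close>, the chosen leaves to neighbours of \<open>z\<close> outside \<open>S\<close>, the rest into \<open>S\<close>.\<close>
  define f where "f v = (if v = p then z else if v \<in> L then h v else g v)" for v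
  have fp: "f p = z" by (simp add: f_def)
  have fL: "f v = h v" "f v \<in> ?N" "f v \<notin> S" if "v \<in> L" for v
    using that \<open>p \<notin> L\<close> h(1) by (auto simp: f_def)
  have fK: "f v = g v" "f v \<in> S - {z}" if "v \<in> pverts T - L - {p}" for v
    using that bij_betwE[OF g] by (auto simp: f_def)
  have fS: "f v \<in> S" if "v \<in> pverts T - L" for v
    using that fp fK(2) S(4) by (cases "v = p") auto
  have inj: "inj_on f (pverts T)"
  proof (rule inj_onI)
    fix u v assume uv: "u \<in> pverts T" "v \<in> pverts T" "f u = f v"
    consider "u \<in> L" "v \<in> L" | "u \<in> pverts T - L" "v \<in> pverts T - L"
      using uv fL(3) fS by (metis DiffI)
    then show "u = v"
    proof cases
      case 1
      then show ?thesis using uv(3) h(2) fL(1) by (auto simp: inj_on_def)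
    next
      case 2
      consider "u = p" "v = p" | "u \<noteq> p" "v \<noteq> p" using 2 uv(3) fp fK(2) by (metis Diff_iff singletonI singletonD)
      then show ?thesis
      proof cases
        case 2
        then show ?thesis
          using \<open>u \<in> pverts T - L\<close> \<open>v \<in> pverts T - L\<close> uv(3) fK(1) g
          by (auto simp: bij_betw_def inj_on_def)
      qed simp
    qed
  qed
  have "f ` pverts T \<subseteq> pverts G"
  proof
    fix y assume "y \<in> f ` pverts T"
    then obtain v where v: "v \<in> pverts T" "y = f v" by blast
    show "y \<in> pverts G" using v fL(2)[of v] fS[of v] S(1) by (cases "v \<in> L") (auto simp: nbhd_def)
  qed
  moreover have "map_prod f f ` parcs T \<subseteq> parcs G"
  proof
    fix a assume "a \<in> map_prod f f ` parcs T"
    then obtain u v where uv: "(u, v) \<in> parcs T" "a = (f u, f v)" by auto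
    have uvT: "u \<in> pverts T" "v \<in> pverts T" using uv pair_wf_parcs[OF pair_graph_wf[OF T(1)]] by auto
    consider "u \<in> L" | "v \<in> L" | "u \<notin> L" "v \<notin> L" by blast
    then show "a \<in> parcs G"
    proof cases
      case 1
      then have "v = p" using leaf uv(1) by blast
      then show ?thesis using 1 uv(2) fp fL(2) G.E_sym by (auto simp: nbhd_def)
    next
      case 2
      then have "u = p" using leaf T.E_sym[OF uv(1)] by blast
      then show ?thesis using 2 uv(2) fp fL(2) by (auto simp: nbhd_def)
    next
      case 3
      have "u \<noteq> v" using uv(1) by auto
      then have "f u \<noteq> f v" using inj uvT by (auto simp: inj_on_def)
      then show ?thesis using 3 uv(2) uvT fS cliqueD[OF S(3), of "f u" "f v"] by blast
    qed
  qed
  ultimately show False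
    using free is_free_iff[OF pair_graph_wf[OF T(1)] pair_graph_wf[OF G]] inj by blast
qed

lemma connected_hom_stays:
  assumes T: "pair_graph T" "Digraph_Component.connected (with_proj T)"
    and f: "f ` pverts T \<subseteq> V" "map_prod f f ` parcs T \<subseteq> E"
    and C: "E `` C \<inter> V \<subseteq> C" and u: "u \<in> pverts T" "f u \<in> C" and v: "v \<in> pverts T"
  shows "f v \<in> C"
proof -
  interpret T: simple_graph "parcs T" by (rule pair_graph_simple[OF T(1)])
  have "parcs (mk_symmetric (with_proj T)) = parcs T"
    using T.E_sym by (auto simp: mk_symmetric_def)
  moreover have "pverts (mk_symmetric (with_proj T)) = pverts T" by (simp add: mk_symmetric_def)
  ultimately have "(u, v) \<in> rtrancl_on (pverts T) (parcs T)"
    using T(2) u v by (auto simp: Digraph_Component.connected_def strongly_connected_def reachable_def)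
  then show ?thesis
  proof (induction rule: rtrancl_on_induct)
    case base
    then show ?case using u by blast
  next
    case (step y w)
    have "(f y, f w) \<in> E" using f(2) step by force
    moreover have "f w \<in> V" using f(1) step by blast
    ultimately show ?case using C step by blast
  qed
qed

text \<open>
  The image of \<open>T\<close> would be trapped in one block, which has \<open>D\<close> vertices, or in the rest, which has
  fewer; but \<open>T\<close> has \<open>Suc D\<close> vertices.
\<close>
lemma clique_decomposition_imp_free:
  assumes T: "is_tree T" "card (pverts T) = Suc D" and D: "0 < D"
    and G: "pair_graph G" and P: "clique_decomposition (parcs G) D r (pverts G) P"
  shows "is_free T G"
proof -
  have Tg: "pair_graph T" and Tc: "Digraph_Component.connected (with_proj T)"
    using T(1) by (auto simp: is_tree_def)
  interpret G: simple_graph "parcs G" by (rule pair_graph_simple[OF G])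
  have finG: "finite (pverts G)" by (rule pair_graph_finite[OF G])
  have False if f: "inj_on f (pverts T)" "f ` pverts T \<subseteq> pverts G" "map_prod f f ` parcs T \<subseteq> parcs G" for f
  proof -
    have large: "Suc D \<le> card W" if "f ` pverts T \<subseteq> W" "W \<subseteq> pverts G" for W
      using card_mono[OF finite_subset[OF that(2) finG] that(1)] T(2) f(1) by (simp add: card_image)
    have stays: "f v \<in> C" if "C \<in> P" "u \<in> pverts T" "f u \<in> C" "v \<in> pverts T" for C u v
      using connected_hom_stays[OF Tg Tc f(2,3) _ that(2,3,4)] P that(1)
      by (auto simp: clique_decomposition_def)
    show False
    proof (cases "\<exists>u\<in>pverts T. f u \<in> \<Union>P")
      case True
      then obtain u C where u: "u \<in> pverts T" "f u \<in> C" "C \<in> P" by blast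
      then have "f ` pverts T \<subseteq> C" using stays by blast
      then show False using large[of C] P u(3) by (auto simp: clique_decomposition_def)
    next
      case False
      then have "f ` pverts T \<subseteq> pverts G - \<Union>P" using f(2) by blast
      then have "Suc D \<le> card (pverts G - \<Union>P)" by (rule large) blast
      then show False
        using G.card_rest_of_clique_decomposition(2)[OF finG P] mod_less_divisor[OF D, of "card (pverts G)"]
        by linarith
    qed
  qed
  then show ?thesis using is_free_iff[OF pair_graph_wf[OF Tg] pair_graph_wf[OF G]] by blast
qed



section \<open>The extremal graphs up to isomorphism\<close>

lemma image_graph_simps [simp]:
  "pverts (image_graph f G) = f ` pverts G" "parcs (image_graph f G) = map_prod f f ` parcs G"
  by (simp_all add: image_graph_def)

lemma image_graph_arc_iff:
  assumes "pair_wf_digraph G" "inj_on f (pverts G)" "u \<in> pverts G" "v \<in> pverts G"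
  shows "(f u, f v) \<in> parcs (image_graph f G) \<longleftrightarrow> (u, v) \<in> parcs G"
proof
  assume "(f u, f v) \<in> parcs (image_graph f G)"
  then obtain a b where ab: "(a, b) \<in> parcs G" "f a = f u" "f b = f v" by auto
  then have "a \<in> pverts G" "b \<in> pverts G" using pair_wf_parcs[OF assms(1)] by auto
  then have "a = u" "b = v" using assms ab by (auto simp: inj_on_def)
  then show "(u, v) \<in> parcs G" using ab by simp
qed force

lemma pair_graph_image_graph:
  assumes G: "pair_graph G" and f: "inj_on f (pverts G)"
  shows "pair_graph (image_graph f G)"
proof (rule pair_graphI)
  interpret simple_graph "parcs G" by (rule pair_graph_simple[OF G])
  have sub: "parcs G \<subseteq> pverts G \<times> pverts G" by (rule pair_wf_parcs[OF pair_graph_wf[OF G]])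
  show "finite (pverts (image_graph f G))" using pair_graph_finite[OF G] by simp
  show "parcs (image_graph f G) \<subseteq> pverts (image_graph f G) \<times> pverts (image_graph f G)"
    using sub by auto
  show "sym (parcs (image_graph f G))"
  proof (rule symI)
    fix x y assume "(x, y) \<in> parcs (image_graph f G)"
    then obtain u v where "(u, v) \<in> parcs G" "x = f u" "y = f v" by auto
    then show "(y, x) \<in> parcs (image_graph f G)" using E_sym[of u v] by force
  qed
  show "irrefl (parcs (image_graph f G))"
    unfolding irrefl_def
  proof (intro allI notI)
    fix x assume "(x, x) \<in> parcs (image_graph f G)"
    then obtain u v where uv: "(u, v) \<in> parcs G" "f u = f v" by auto
    then have "u = v" using f sub by (auto simp: inj_on_def)
    then show False using uv(1) by simp
  qed
qed

lemma clique_decomposition_image_graph: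
  assumes G: "pair_graph G" and f: "inj_on f (pverts G)"
    and P: "clique_decomposition (parcs G) D r (pverts G) P"
  shows "clique_decomposition (parcs (image_graph f G)) D r (pverts (image_graph f G)) ((`) f ` P)"
proof -
  note arc = image_graph_arc_iff[OF pair_graph_wf[OF G] f]
  have PV: "C \<subseteq> pverts G" if "C \<in> P" for C using P that by (auto simp: clique_decomposition_def)
  have cl: "clique (parcs (image_graph f G)) (f ` C)" if "clique (parcs G) C" "C \<subseteq> pverts G" for C
    unfolding clique_def
  proof (intro ballI impI)
    fix x y assume "x \<in> f ` C" "y \<in> f ` C" "x \<noteq> y"
    then obtain u v where "u \<in> C" "v \<in> C" "x = f u" "y = f v" "u \<noteq> v" by auto
    then show "(x, y) \<in> parcs (image_graph f G)"
      using that arc[of u v] cliqueD[OF that(1), of u v] by blast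
  qed
  have cV: "card (f ` pverts G) = card (pverts G)" using f by (rule card_image)
  show ?thesis
    unfolding clique_decomposition_def
  proof (intro conjI ballI)
    fix K assume "K \<in> (`) f ` P"
    then obtain C where C: "C \<in> P" "K = f ` C" by blast
    show "K \<subseteq> pverts (image_graph f G)" using C PV by auto
    show "card K = D"
      using C P card_image[OF inj_on_subset[OF f PV[OF C(1)]]] by (simp add: clique_decomposition_def)
    show "clique (parcs (image_graph f G)) K"
      using C cl PV P by (simp add: clique_decomposition_def)
    show "parcs (image_graph f G) `` K \<inter> pverts (image_graph f G) \<subseteq> K"
    proof
      fix y assume "y \<in> parcs (image_graph f G) `` K \<inter> pverts (image_graph f G)"
      then obtain x v where v: "x \<in> K" "v \<in> pverts G" "y = f v" "(x, y) \<in> parcs (image_graph f G)"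
        unfolding image_graph_simps(1) by blast
      then obtain u where "u \<in> C" "x = f u" using C(2) by blast
      then have uv: "u \<in> C" "v \<in> pverts G" "y = f v" "(f u, f v) \<in> parcs (image_graph f G)"
        using v by simp_all
      then have "(u, v) \<in> parcs G" using arc[of u v] PV[OF C(1)] by blast
      then have "v \<in> C" using P C(1) uv(1,2) unfolding clique_decomposition_def by blast
      then show "y \<in> K" using C(2) uv(3) by blast
    qed
  next
    show "disjoint ((`) f ` P)"
      unfolding disjoint_def
    proof (intro ballI impI)
      fix K L assume KL: "K \<in> (`) f ` P" "L \<in> (`) f ` P" "K \<noteq> L"
      then obtain A B where AB: "A \<in> P" "B \<in> P" "K = f ` A" "L = f ` B" by blast
      then have "A \<noteq> B" using KL(3) by blast
      then have "A \<inter> B = {}" using P AB(1,2) unfolding clique_decomposition_def disjoint_def by blast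
      then show "K \<inter> L = {}"
        using AB inj_on_image_Int[OF f PV[OF AB(1)] PV[OF AB(2)]] by simp
    qed
    have "inj_on ((`) f) P"
      using inj_on_image_Pow[OF f] by (rule inj_on_subset) (use PV in blast)
    then show "card ((`) f ` P) = card (pverts (image_graph f G)) div D"
      using P cV by (simp add: card_image clique_decomposition_def)
    have "f ` (pverts G - \<Union>P) = f ` pverts G - f ` \<Union>P"
      using PV by (intro inj_on_image_set_diff[OF f]) auto
    then have eq: "pverts (image_graph f G) - \<Union>((`) f ` P) = f ` (pverts G - \<Union>P)"
      by auto
    show "r \<le> card (pverts (image_graph f G)) mod D \<longrightarrow>
        clique (parcs (image_graph f G)) (pverts (image_graph f G) - \<Union>((`) f ` P))"
      unfolding eq using P cl cV by (simp add: clique_decomposition_def)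
  qed
qed

abbreviation (input) cliques_with_rest :: "nat \<Rightarrow> nat \<Rightarrow> 'a pair_pre_digraph \<Rightarrow> (nat \<times> nat + 'a) pair_pre_digraph" where
  "cliques_with_rest \<alpha> D H \<equiv> disjoint_union (disjoint_copies \<alpha> (complete_graph D)) H"

lemma cliques_with_rest_simps:
  "pverts (cliques_with_rest \<alpha> D H) = ({..<\<alpha>} \<times> {..<D}) <+> pverts H"
  "parcs (cliques_with_rest \<alpha> D H) =
    {(Inl (i, x), Inl (i, y)) | i x y. i < \<alpha> \<and> x < D \<and> y < D \<and> x \<noteq> y} \<union>
    {(Inr u, Inr v) | u v. (u, v) \<in> parcs H}"
  by (auto simp: disjoint_union_def disjoint_copies_def complete_graph_def)

lemma card_cliques_with_rest:
  assumes "finite (pverts H)"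
  shows "card (pverts (cliques_with_rest \<alpha> D H)) = \<alpha> * D + card (pverts H)"
  using assms by (simp add: cliques_with_rest_simps card_Plus)

lemma pair_graph_cliques_with_rest:
  assumes H: "pair_graph H"
  shows "pair_graph (cliques_with_rest \<alpha> D H)"
proof (rule pair_graphI)
  interpret simple_graph "parcs H" by (rule pair_graph_simple[OF H])
  show "finite (pverts (cliques_with_rest \<alpha> D H))"
    using pair_graph_finite[OF H] by (simp add: cliques_with_rest_simps)
  show "parcs (cliques_with_rest \<alpha> D H) \<subseteq> pverts (cliques_with_rest \<alpha> D H) \<times> pverts (cliques_with_rest \<alpha> D H)"
    using pair_wf_parcs[OF pair_graph_wf[OF H]] by (auto simp: cliques_with_rest_simps)
  show "sym (parcs (cliques_with_rest \<alpha> D H))"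
    by (rule symI) (auto simp: cliques_with_rest_simps dest: E_sym)
  show "irrefl (parcs (cliques_with_rest \<alpha> D H))"
    by (auto simp: irrefl_def cliques_with_rest_simps)
qed

lemma clique_decomposition_cliques_with_rest:
  assumes H: "pair_graph H" "card (pverts H) < D" "r \<le> card (pverts H) \<longrightarrow> clique (parcs H) (pverts H)"
  shows "\<exists>P. clique_decomposition (parcs (cliques_with_rest \<alpha> D H)) D r (pverts (cliques_with_rest \<alpha> D H)) P"
proof -
  let ?G = "cliques_with_rest \<alpha> D H"
  define B where "B i = (Inl ` ({i} \<times> {..<D}) :: (nat \<times> nat + 'a) set)" for i
  have card: "card (pverts ?G) = \<alpha> * D + card (pverts H)"
    by (rule card_cliques_with_rest[OF pair_graph_finite[OF H(1)]])
  have "0 < D" using H(2) by linarith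
  have inj: "inj_on B {..<\<alpha>}"
  proof (rule inj_onI)
    fix i j assume "B i = B j"
    moreover have "Inl (i, 0) \<in> B i" using \<open>0 < D\<close> by (auto simp: B_def)
    ultimately show "i = j" by (auto simp: B_def)
  qed
  have "clique_decomposition (parcs ?G) D r (pverts ?G) (B ` {..<\<alpha>})"
    unfolding clique_decomposition_def
  proof (intro conjI ballI)
    fix C assume "C \<in> B ` {..<\<alpha>}"
    then obtain i where i: "i < \<alpha>" "C = B i" by blast
    show "C \<subseteq> pverts ?G" using i by (auto simp: B_def cliques_with_rest_simps)
    show "card C = D" by (simp add: i B_def card_image card_cartesian_product)
    show "clique (parcs ?G) C" using i by (auto simp: B_def clique_def cliques_with_rest_simps)
    show "parcs ?G `` C \<inter> pverts ?G \<subseteq> C" using i by (auto simp: B_def cliques_with_rest_simps)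
  next
    show "disjoint (B ` {..<\<alpha>})" by (auto simp: disjoint_def B_def)
    have "card (pverts ?G) div D = \<alpha>" unfolding card using H(2) by simp
    then show "card (B ` {..<\<alpha>}) = card (pverts ?G) div D" using inj by (simp add: card_image)
    have "pverts ?G - \<Union>(B ` {..<\<alpha>}) = Inr ` pverts H" by (auto simp: B_def cliques_with_rest_simps)
    moreover have "clique (parcs ?G) (Inr ` pverts H)" if "clique (parcs H) (pverts H)"
      using that by (auto simp: clique_def cliques_with_rest_simps)
    moreover have "card (pverts ?G) mod D = card (pverts H)" unfolding card using H(2) by simp
    ultimately show "r \<le> card (pverts ?G) mod D \<longrightarrow> clique (parcs ?G) (pverts ?G - \<Union>(B ` {..<\<alpha>}))"
      using H(3) by simp
  qed
  then show ?thesis by blast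
qed

text \<open>
  The isomorphism numbers the blocks of \<open>P\<close> and the vertices within each block; the rest is moved to
  an initial segment of the natural numbers, so that a complete rest becomes \<open>complete_graph \<beta>\<close> itself
  and not just a graph isomorphic to it.
\<close>
lemma clique_decomposition_imp_iso:
  assumes G: "pair_graph G" and P: "clique_decomposition (parcs G) D r (pverts G) P"
    and n: "card (pverts G) = \<alpha> * D + \<beta>" "\<beta> < D"
  shows "\<exists>H :: nat pair_pre_digraph. pair_graph H \<and> card (pverts H) = \<beta> \<and>
    (r \<le> \<beta> \<longrightarrow> H = complete_graph \<beta>) \<and> digraph_iso (with_proj G) (with_proj (cliques_with_rest \<alpha> D H))"
proof -
  interpret G: simple_graph "parcs G" by (rule pair_graph_simple[OF G])
  have fin: "finite (pverts G)" by (rule pair_graph_finite[OF G])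
  have sub: "parcs G \<subseteq> pverts G \<times> pverts G" by (rule pair_wf_parcs[OF pair_graph_wf[OF G]])
  define R where "R = pverts G - \<Union>P"
  have div_mod: "card (pverts G) div D = \<alpha>" "card (pverts G) mod D = \<beta>" using n by simp_all
  have C: "C \<subseteq> pverts G" "card C = D" "clique (parcs G) C" "parcs G `` C \<inter> pverts G \<subseteq> C" "finite C"
    if "C \<in> P" for C
    using P that finite_subset[OF _ fin] by (auto simp: clique_decomposition_def)
  have disj: "A = B" if "A \<in> P" "B \<in> P" "v \<in> A" "v \<in> B" for A B v
    using P that unfolding clique_decomposition_def disjoint_def by blast
  have finP: "finite P" and cardR: "card R = \<beta>"
    using G.card_rest_of_clique_decomposition[OF fin P] by (simp_all add: R_def div_mod)
  have "card P = \<alpha>" using P div_mod by (simp add: clique_decomposition_def)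
  then obtain e where e: "bij_betw e P {..<\<alpha>}"
    using finite_same_card_bij[OF finP, of "{..<\<alpha>}"] by auto
  have "\<forall>K\<in>P. \<exists>h. bij_betw h K {..<D}"
    using C(2,5) by (intro ballI finite_same_card_bij) auto
  then obtain g where g: "\<And>K. K \<in> P \<Longrightarrow> bij_betw (g K) K {..<D}" by metis
  have finR: "finite R" using fin by (simp add: R_def)
  then obtain b where b: "bij_betw b R {..<\<beta>}"
    using finite_same_card_bij[of R "{..<\<beta>}"] cardR by auto
  define R_graph where "R_graph = \<lparr> pverts = R, parcs = parcs G \<inter> (R \<times> R) \<rparr>"
  define H where "H = image_graph b R_graph"
  have R_graph: "pair_graph R_graph"
    by (rule pair_graphI)
       (use finR in \<open>auto simp: R_graph_def sym_def irrefl_def dest: G.E_sym\<close>)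
  have b': "inj_on b R" "b ` R = {..<\<beta>}" using b by (simp_all add: bij_betw_def)
  have H: "pair_graph H"
    unfolding H_def by (rule pair_graph_image_graph[OF R_graph]) (simp add: R_graph_def b')
  have vH: "pverts H = {..<\<beta>}" by (simp add: H_def R_graph_def b')
  have aH: "parcs H = {(b u, b v) | u v. (u, v) \<in> parcs G \<and> u \<in> R \<and> v \<in> R}"
    by (auto simp: H_def R_graph_def)
  have complete: "H = complete_graph \<beta>" if "r \<le> \<beta>"
  proof -
    have cl: "clique (parcs G) R" using P that div_mod by (simp add: clique_decomposition_def R_def)
    have "parcs H = {(i, j). i < \<beta> \<and> j < \<beta> \<and> i \<noteq> j}"
    proof (intro equalityI subsetI)
      fix a assume "a \<in> parcs H"
      then obtain u v where uv: "a = (b u, b v)" "(u, v) \<in> parcs G" "u \<in> R" "v \<in> R" unfolding aH by blast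
      then have "u \<noteq> v" by auto
      then have "b u \<noteq> b v" using b'(1) uv by (auto simp: inj_on_def)
      moreover have "b u < \<beta>" "b v < \<beta>" using b'(2) uv by auto
      ultimately show "a \<in> {(i, j). i < \<beta> \<and> j < \<beta> \<and> i \<noteq> j}" using uv(1) by simp
    next
      fix a assume "a \<in> {(i, j). i < \<beta> \<and> j < \<beta> \<and> i \<noteq> j}"
      then obtain i j where ij: "a = (i, j)" "i \<in> b ` R" "j \<in> b ` R" "i \<noteq> j" unfolding b'(2) by auto
      then obtain u v where "u \<in> R" "v \<in> R" "i = b u" "j = b v" "u \<noteq> v" by blast
      then show "a \<in> parcs H" unfolding aH using ij(1) cliqueD[OF cl, of u v] by blast
    qed
    then show ?thesis using vH by (simp add: complete_graph_def pair_pre_digraph.equality)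
  qed
  \<comment> \<open>The blocks are disjoint, so a vertex outside \<open>R\<close> determines its block.\<close>
  define block where "block v = (THE K. K \<in> P \<and> v \<in> K)" for v
  have block: "block v = K" if "K \<in> P" "v \<in> K" for K v
    unfolding block_def
  proof (rule the_equality)
    show "L = K" if "L \<in> P \<and> v \<in> L" for L using that \<open>K \<in> P\<close> \<open>v \<in> K\<close> disj by blast
  qed (use that in simp)
  define f where "f v = (if v \<in> R then Inr (b v) else Inl (e (block v), g (block v) v))" for v
  have fR: "f v = Inr (b v)" if "v \<in> R" for v using that by (simp add: f_def)
  have fP: "f v = Inl (e K, g K v)" if "K \<in> P" "v \<in> K" for K v
    using that block[OF that] by (auto simp: f_def R_def)
  have cases: "v \<in> R \<or> (\<exists>K\<in>P. v \<in> K)" if "v \<in> pverts G" for v using that by (auto simp: R_def)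
  have inj: "inj_on f (pverts G)"
  proof (rule inj_onI)
    fix u v assume uv: "u \<in> pverts G" "v \<in> pverts G" "f u = f v"
    show "u = v"
    proof (cases "u \<in> R")
      case True
      then have "v \<in> R" using cases[OF uv(2)] uv(3) fR fP by fastforce
      then show ?thesis using True uv(3) b'(1) by (simp add: fR inj_on_def)
    next
      case False
      then obtain K where K: "K \<in> P" "u \<in> K" using cases[OF uv(1)] by blast
      then obtain L where L: "L \<in> P" "v \<in> L" using cases[OF uv(2)] uv(3) fR fP by fastforce
      have eq: "e K = e L" "g K u = g L v" using uv(3) fP[OF K] fP[OF L] by auto
      then have "K = L" using e K L by (auto simp: bij_betw_def inj_on_def)
      then show ?thesis using eq g[OF K(1)] K L by (auto simp: bij_betw_def inj_on_def)
    qed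
  qed
  let ?U = "cliques_with_rest \<alpha> D H"
  have verts: "f ` pverts G = pverts ?U"
  proof (intro equalityI subsetI)
    fix y assume "y \<in> f ` pverts G"
    then obtain v where v: "v \<in> pverts G" "y = f v" by blast
    show "y \<in> pverts ?U"
    proof (cases "v \<in> R")
      case True
      then show ?thesis using v fR b'(2) by (auto simp: cliques_with_rest_simps vH)
    next
      case False
      then obtain K where K: "K \<in> P" "v \<in> K" using cases[OF v(1)] by blast
      then have "e K < \<alpha>" "g K v < D" using bij_betwE[OF e] bij_betwE[OF g[OF K(1)]] by auto
      then show ?thesis using v fP[OF K] by (auto simp: cliques_with_rest_simps)
    qed
  next
    fix y assume "y \<in> pverts ?U"
    then consider i x where "y = Inl (i, x)" "i < \<alpha>" "x < D" | j where "y = Inr j" "j < \<beta>"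
      by (auto simp: cliques_with_rest_simps vH)
    then show "y \<in> f ` pverts G"
    proof cases
      case 1
      then have "i \<in> e ` P" using e by (simp add: bij_betw_def)
      then obtain K where K: "K \<in> P" "i = e K" by blast
      have "x \<in> g K ` K" using 1 g[OF K(1)] by (simp add: bij_betw_def)
      then obtain v where v: "v \<in> K" "x = g K v" by blast
      have "y = f v" using 1 K v fP by simp
      then show ?thesis using C(1)[OF K(1)] v by blast
    next
      case 2
      then obtain v where "v \<in> R" "j = b v" using b'(2) by blast
      then have "y = f v" "v \<in> pverts G" using 2 fR by (simp_all add: R_def)
      then show ?thesis by blast
    qed
  qed
  have arcs: "map_prod f f ` parcs G = parcs ?U"
  proof (intro equalityI subsetI)
    fix a assume "a \<in> map_prod f f ` parcs G"
    then obtain u v where uv: "(u, v) \<in> parcs G" "a = (f u, f v)" by auto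
    have uvG: "u \<in> pverts G" "v \<in> pverts G" using uv(1) sub by auto
    show "a \<in> parcs ?U"
    proof (cases "u \<in> R")
      case True
      have "v \<in> R"
      proof (rule ccontr)
        assume "v \<notin> R"
        then obtain K where K: "K \<in> P" "v \<in> K" using cases[OF uvG(2)] by blast
        then have "u \<in> K" using C(4)[OF K(1)] G.E_sym[OF uv(1)] uvG(1) by blast
        then show False using True K(1) by (auto simp: R_def)
      qed
      then show ?thesis using True uv by (auto simp: cliques_with_rest_simps fR aH)
    next
      case False
      then obtain K where K: "K \<in> P" "u \<in> K" using cases[OF uvG(1)] by blast
      then have v: "v \<in> K" using C(4)[OF K(1)] uv(1) uvG(2) by blast
      have "u \<noteq> v" using uv(1) by auto
      then have "g K u \<noteq> g K v" "g K u < D" "g K v < D" "e K < \<alpha>"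
        using g[OF K(1)] e K v by (auto simp: bij_betw_def inj_on_def)
      then show ?thesis using uv(2) fP[OF K] fP[OF K(1) v] by (auto simp: cliques_with_rest_simps)
    qed
  next
    fix a assume "a \<in> parcs ?U"
    then consider i x y where "a = (Inl (i, x), Inl (i, y))" "i < \<alpha>" "x < D" "y < D" "x \<noteq> y"
      | j k where "a = (Inr j, Inr k)" "(j, k) \<in> parcs H"
      by (auto simp: cliques_with_rest_simps)
    then show "a \<in> map_prod f f ` parcs G"
    proof cases
      case 1
      then have "i \<in> e ` P" using e by (simp add: bij_betw_def)
      then obtain K where K: "K \<in> P" "i = e K" by blast
      have "x \<in> g K ` K" "y \<in> g K ` K" using 1 g[OF K(1)] by (simp_all add: bij_betw_def)
      then obtain u v where uv: "u \<in> K" "x = g K u" "v \<in> K" "y = g K v" by blast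
      then have "u \<noteq> v" using 1 by blast
      then have "(u, v) \<in> parcs G" using cliqueD[OF C(3)[OF K(1)]] uv by blast
      moreover have "a = map_prod f f (u, v)" using 1 K uv fP by simp
      ultimately show ?thesis by (rule rev_image_eqI)
    next
      case 2
      then obtain u v where uv: "j = b u" "k = b v" "(u, v) \<in> parcs G" "u \<in> R" "v \<in> R"
        unfolding aH by blast
      moreover have "a = map_prod f f (u, v)" using 2 uv fR by simp
      ultimately show ?thesis by (intro rev_image_eqI[of "(u, v)"])
    qed
  qed
  have "?U = image_graph f G" using verts arcs by (intro pair_pre_digraph.equality) simp_all
  then have "digraph_iso (with_proj G) (with_proj ?U)"
    using digraph_iso_pair_iff inj pair_graph_wf[OF G] by blast
  then show ?thesis using H vH complete by (intro exI[of _ H]) simp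
qed

lemma image_graph_inverse:
  assumes "pair_wf_digraph G" "inj_on f (pverts G)"
  shows "image_graph (inv_into (pverts G) f) (image_graph f G) = G"
proof (rule pair_pre_digraph.equality)
  let ?g = "inv_into (pverts G) f"
  have inv: "?g (f v) = v" if "v \<in> pverts G" for v using that assms(2) by simp
  show "pverts (image_graph ?g (image_graph f G)) = pverts G"
    using inv by (force simp: image_image)
  have "map_prod ?g ?g (map_prod f f a) = a" if "a \<in> parcs G" for a
    using that pair_wf_parcs[OF assms(1)] inv by (cases a) auto
  then show "parcs (image_graph ?g (image_graph f G)) = parcs G"
    by (simp add: image_image)
qed simp

lemma iso_imp_clique_decomposition:
  assumes H: "pair_graph H" "card (pverts H) = \<beta>" "r \<le> \<beta> \<longrightarrow> H = complete_graph \<beta>" and "\<beta> < D"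
    and iso: "digraph_iso (with_proj G) (with_proj (cliques_with_rest \<alpha> D H))"
  shows "pair_graph G" and "card (pverts G) = \<alpha> * D + \<beta>"
    and "\<exists>P. clique_decomposition (parcs G) D r (pverts G) P"
proof -
  let ?U = "cliques_with_rest \<alpha> D H"
  obtain f where G: "pair_wf_digraph G" and f: "inj_on f (pverts G)" and U: "?U = image_graph f G"
    using iso digraph_iso_pair_iff by blast
  let ?g = "inv_into (pverts G) f"
  have G_eq: "G = image_graph ?g ?U" unfolding U using image_graph_inverse[OF G f] by simp
  have inj: "inj_on ?g (pverts ?U)" unfolding U by (simp add: inj_on_inv_into)
  have gU: "pair_graph ?U" by (rule pair_graph_cliques_with_rest[OF H(1)])
  have "clique (parcs H) (pverts H)" if "r \<le> \<beta>"
    using H(3) that by (auto simp: clique_def complete_graph_def)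
  then obtain P where P: "clique_decomposition (parcs ?U) D r (pverts ?U) P"
    using clique_decomposition_cliques_with_rest[OF H(1), of D r \<alpha>] H(2) assms(4) by blast
  show "pair_graph G" by (subst G_eq) (rule pair_graph_image_graph[OF gU inj])
  show "card (pverts G) = \<alpha> * D + \<beta>"
    using card_cliques_with_rest[OF pair_graph_finite[OF H(1)], of \<alpha> D] card_image[OF f] H(2)
    unfolding U by simp
  show "\<exists>P. clique_decomposition (parcs G) D r (pverts G) P"
    using clique_decomposition_image_graph[OF gU inj P] unfolding G_eq[symmetric] by blast
qed

section \<open>The extremal number and the extremal graphs\<close>

lemma card_copies_le:
  assumes T: "pair_graph T" "card (pverts T) = Suc D" and r: "3 \<le> r" "r \<le> D"
    and leaves: "\<exists>p \<in> pverts T. Suc D - r \<le>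
           card {v \<in> pverts T. (p, v) \<in> parcs T \<and> out_degree (with_proj T) v = 1}"
    and G: "G \<in> free_graphs n T"
  shows "card (copies (complete_graph r) G) \<le> clique_bound D r n"
    and "card (copies (complete_graph r) G) = clique_bound D r n \<Longrightarrow>
      \<exists>P. clique_decomposition (parcs G) D r (pverts G) P"
proof -
  have g: "pair_graph G" "card (pverts G) = n" "is_free T G" using G by (auto simp: free_graphs_def)
  interpret simple_graph "parcs G" by (rule pair_graph_simple[OF g(1)])
  obtain p where p: "p \<in> pverts T" "Suc D - r \<le>
      card {v \<in> pverts T. (p, v) \<in> parcs T \<and> out_degree (with_proj T) v = 1}"
    using leaves by blast
  have deg: "\<forall>z\<in>\<Union>(cliques (parcs G) r (pverts G)). card (nbhd (parcs G) (pverts G) z) < D"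
    using free_imp_degree_lt[OF T _ _ p g(1,3)] r by simp
  note fin = pair_graph_finite[OF g(1)]
  show "card (copies (complete_graph r) G) \<le> clique_bound D r n"
    using card_cliques_le[OF fin r(1) deg] g by (simp add: card_copies_complete_graph)
  show "\<exists>P. clique_decomposition (parcs G) D r (pverts G) P"
    if "card (copies (complete_graph r) G) = clique_bound D r n"
    using tight_imp_clique_decomposition[OF fin r deg] that g
    by (simp add: card_copies_complete_graph)
qed

lemma clique_decomposition_imp_tight:
  assumes T: "is_tree T" "card (pverts T) = Suc D" and "1 \<le> r" "0 < D"
    and G: "pair_graph G" and P: "clique_decomposition (parcs G) D r (pverts G) P"
  shows "G \<in> free_graphs (card (pverts G)) T"
    and "card (copies (complete_graph r) G) = clique_bound D r (card (pverts G))"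
  using clique_decomposition_imp_free[OF T assms(4) G P] G
    simple_graph.card_cliques_of_clique_decomposition[OF pair_graph_simple[OF G]
      pair_graph_finite[OF G] assms(3) P]
  by (simp_all add: free_graphs_def card_copies_complete_graph)

lemma clique_decomposition_iff_iso:
  assumes "\<beta> < D"
  shows "pair_graph G \<and> card (pverts G) = \<alpha> * D + \<beta> \<and>
      (\<exists>P. clique_decomposition (parcs G) D r (pverts G) P) \<longleftrightarrow>
    (\<exists>H :: nat pair_pre_digraph. pair_graph H \<and> card (pverts H) = \<beta> \<and>
      (r \<le> \<beta> \<longrightarrow> H = complete_graph \<beta>) \<and>
      digraph_iso (with_proj G) (with_proj (cliques_with_rest \<alpha> D H)))"
  (is "?L \<longleftrightarrow> ?R")
proof
  assume ?L
  then show ?R using clique_decomposition_imp_iso[OF _ _ _ assms] by blast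
next
  assume ?R
  then obtain H :: "nat pair_pre_digraph" where "pair_graph H" "card (pverts H) = \<beta>"
    "r \<le> \<beta> \<longrightarrow> H = complete_graph \<beta>"
    "digraph_iso (with_proj G) (with_proj (cliques_with_rest \<alpha> D H))" by blast
  note iso_imp_clique_decomposition[OF this(1-3) assms this(4)]
  then show ?L by blast
qed

text \<open>
  The extremal number is a maximum over graphs on natural numbers, so a graph attaining it must be
  provided there.
\<close>
lemma ex_clique_decomposition_nat:
  assumes "\<beta> < D"
  shows "\<exists>(G :: nat pair_pre_digraph) P. pair_graph G \<and> card (pverts G) = \<alpha> * D + \<beta> \<and>
    clique_decomposition (parcs G) D r (pverts G) P"
proof -
  let ?U = "cliques_with_rest \<alpha> D (complete_graph \<beta>)"
  have U: "pair_graph ?U" by (rule pair_graph_cliques_with_rest[OF pair_graph_complete_graph])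
  have inj: "inj_on to_nat (pverts ?U)" by (rule inj_on_subset[OF inj_to_nat]) simp
  have \<beta>: "pverts (complete_graph \<beta>) = {..<\<beta>}" by (simp add: complete_graph_def)
  have "clique (parcs (complete_graph \<beta>)) (pverts (complete_graph \<beta>))"
    by (simp add: clique_def complete_graph_def)
  then obtain P where P: "clique_decomposition (parcs ?U) D r (pverts ?U) P"
    using clique_decomposition_cliques_with_rest[OF pair_graph_complete_graph[of \<beta>], of D r \<alpha>] assms
    by (auto simp: \<beta>)
  have "card (pverts (image_graph to_nat ?U)) = \<alpha> * D + \<beta>"
    using card_image[OF inj] card_cliques_with_rest[of "complete_graph \<beta>" \<alpha> D] by (simp add: \<beta>)
  then show ?thesis
    using pair_graph_image_graph[OF U inj] clique_decomposition_image_graph[OF U inj P] by blast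
qed

theorem theorem1p5:
  fixes T :: "'a pair_pre_digraph" and t r n \<alpha> \<beta> :: nat
  assumes "is_tree T" and "card (pverts T) = t"
    and "3 \<le> r" and "r \<le> t - 1"
    and "\<exists>p \<in> pverts T. t - r \<le>
           card {v \<in> pverts T. (p, v) \<in> parcs T \<and> out_degree (with_proj T) v = 1}"
    and "n = \<alpha> * (t - 1) + \<beta>" and "\<beta> \<le> t - 2"
  shows "ex n (complete_graph r) T = \<alpha> * ((t - 1) choose r) + (\<beta> choose r) \<and>
    (\<forall>G :: 'g pair_pre_digraph.
       extremal n (complete_graph r) T G \<longleftrightarrow>
       (\<exists>H :: nat pair_pre_digraph. pair_graph H \<and> card (pverts H) = \<beta> \<and>
          (r \<le> \<beta> \<longrightarrow> H = complete_graph \<beta>) \<and>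
          digraph_iso (with_proj G)
            (with_proj (disjoint_union (disjoint_copies \<alpha> (complete_graph (t - 1))) H))))"
proof -
  define D where "D = t - 1"
  have T: "pair_graph T" using assms(1) by (simp add: is_tree_def)
  have D: "r \<le> D" "0 < D" "t = Suc D" "\<beta> < D" using assms(3,4,7) by (auto simp: D_def)
  have n: "n = \<alpha> * D + \<beta>" using assms(6) by (simp add: D_def)
  have card_T: "card (pverts T) = Suc D" using assms(2) D(3) by simp
  let ?K = "complete_graph r" and ?m = "\<alpha> * (D choose r) + (\<beta> choose r)"
  have bound_n: "clique_bound D r n = ?m" using n D(4) by (simp add: clique_bound_def)
  note le = card_copies_le[OF T card_T assms(3) D(1) assms(5)[unfolded D(3)], where n = n, unfolded bound_n]
  note tight = clique_decomposition_imp_tight[OF assms(1) card_T _ D(2), where r = r]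
  have r1: "1 \<le> r" using assms(3) by simp
  let ?values = "(\<lambda>G. card (copies ?K G)) ` (free_graphs n T :: nat pair_pre_digraph set)"
  obtain G0 :: "nat pair_pre_digraph" and P where G0: "pair_graph G0" "card (pverts G0) = n"
    "clique_decomposition (parcs G0) D r (pverts G0) P"
    using ex_clique_decomposition_nat[OF D(4), of \<alpha> r] n by blast
  have attained: "?m \<in> ?values"
    using tight[OF r1 G0(1,3)] G0(2) bound_n by (intro rev_image_eqI[of G0]) auto
  have ex: "ex n ?K T = ?m"
    unfolding ex_def
  proof (rule Max_eqI[OF _ _ attained])
    show "finite ?values"
      by (rule finite_subset[of _ "{..?m}"]) (use le(1) in auto)
    show "y \<le> ?m" if "y \<in> ?values" for y
      using that le(1) by auto
  qed
  have "extremal n ?K T G \<longleftrightarrow> pair_graph G \<and> card (pverts G) = \<alpha> * D + \<beta> \<and>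
      (\<exists>P. clique_decomposition (parcs G) D r (pverts G) P)" (is "?L \<longleftrightarrow> ?R")
    for G :: "'g pair_pre_digraph"
  proof
    assume ?L
    then have G: "G \<in> free_graphs n T" "card (copies ?K G) = ?m" by (simp_all add: extremal_def ex)
    then show ?R using le(2)[OF G] n by (simp add: free_graphs_def)
  next
    assume ?R
    then obtain P where G: "pair_graph G" "card (pverts G) = n"
      "clique_decomposition (parcs G) D r (pverts G) P" using n by auto
    show ?L using tight[OF r1 G(1,3)] G(2) bound_n by (simp add: extremal_def ex)
  qed
  with ex show ?thesis
    unfolding D_def[symmetric] clique_decomposition_iff_iso[OF D(4), symmetric] by blast
qed

end
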